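(* Fix integers $g\ge0$, $n\ge1$, $d\ge1$ with $m:=1-2g+n-d\ge1$. Then there is a symmetric polynomial $P(\gamma_1,\dots,\gamma_d)$ in $d$ variables, of total degree at most $2g$, such that for every partition $\gamma=(\gamma_1,\dots,\gamma_d)\vdash n$ with exactly $d$ parts, $$\frac{\mathrm{Aut}(\gamma)}{n!}\,\mu_{n,m}(\gamma)=P(\gamma_1,\dots,\gamma_d).$$
   Context: Fix $\omega=(1\,2\,\cdots\,n)$. For $\gamma\vdash n$ and $m\ge1$, $\mu_{n,m}(\gamma)$ is the number of pairs $(\sigma,\pi)$ of permutations of $[n]$ with $\sigma\pi=\omega$, $\sigma$ of cycle type $\gamma$, and $\pi$ having exactly $m$ cycles. For $\gamma=[1^{a_1},\dots,n^{a_n}]$ (i.e. $a_i$ parts equal to $i$), $\mathrm{Aut}(\gamma)=\prod_i a_i!$. *)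

theory Defs
  imports Complex_Main "HOL-Library.Multiset" "HOL-Combinatorics.Permutations" "HOL-Combinatorics.Orbits"
begin

definition long_cycle :: "nat \<Rightarrow> nat \<Rightarrow> nat" where
  "long_cycle n i = (if 1 \<le> i \<and> i < n then i + 1 else if i = n \<and> n \<ge> 1 then 1 else i)"

definition cycles_of :: "nat \<Rightarrow> (nat \<Rightarrow> nat) \<Rightarrow> nat set set" where
  "cycles_of n p = (\<lambda>x. orbit p x) ` {1..n}"

definition num_cycles :: "nat \<Rightarrow> (nat \<Rightarrow> nat) \<Rightarrow> nat" where
  "num_cycles n p = card (cycles_of n p)"

definition cycle_type :: "nat \<Rightarrow> (nat \<Rightarrow> nat) \<Rightarrow> nat multiset" where
  "cycle_type n p = image_mset card (mset_set (cycles_of n p))"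

definition mu :: "nat \<Rightarrow> nat \<Rightarrow> nat list \<Rightarrow> nat" where
  "mu n m \<gamma> = card {(\<sigma>, \<pi>). \<sigma> permutes {1..n} \<and> \<pi> permutes {1..n} \<and>
      \<sigma> \<circ> \<pi> = long_cycle n \<and> cycle_type n \<sigma> = mset \<gamma> \<and> num_cycles n \<pi> = m}"

definition Aut :: "nat list \<Rightarrow> nat" where
  "Aut \<gamma> = (\<Prod>i\<in>set \<gamma>. fact (count (mset \<gamma>) i))"

definition is_partition :: "nat \<Rightarrow> nat \<Rightarrow> nat list \<Rightarrow> bool" where
  "is_partition n d \<gamma> \<longleftrightarrow> length \<gamma> = d \<and> (\<forall>x\<in>set \<gamma>. 0 < x) \<and>
     sorted_wrt (\<ge>) \<gamma> \<and> sum_list \<gamma> = n"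

text \<open>A polynomial in d variables of total degree at most D, given by its coefficient
  function c on exponent vectors (lists of length d); evaluation at x.\<close>
definition exps :: "nat \<Rightarrow> nat \<Rightarrow> nat list set" where
  "exps d D = {e. length e = d \<and> sum_list e \<le> D}"

definition poly_eval :: "nat \<Rightarrow> nat \<Rightarrow> (nat list \<Rightarrow> rat) \<Rightarrow> rat list \<Rightarrow> rat" where
  "poly_eval d D c x = (\<Sum>e\<in>exps d D. c e * (\<Prod>i<d. (x ! i) ^ (e ! i)))"

definition symmetric_coeffs :: "(nat list \<Rightarrow> rat) \<Rightarrow> bool" where
  "symmetric_coeffs c \<longleftrightarrow> (\<forall>e e'. mset e = mset e' \<longrightarrow> c e = c e')"

end

theory Submission
  imports Defs "HOL-Computational_Algebra.Polynomial" "HOL-Computational_Algebra.Formal_Power_Series"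
begin

text \<open>
  For a fixed permutation \<open>s\<close> of an \<open>n\<close>-set, let \<open>F s q\<close> be the sum of \<open>q\<close> to the number of
  cycles of \<open>s\<^sup>-\<^sup>1 w\<close> over all \<open>n\<close>-cycles \<open>w\<close>. Removing one point \<open>z\<close> from \<open>s\<close> and \<open>w\<close> gives a
  recurrence: if \<open>s = (z i) t\<close>, then \<open>F s\<close> is \<open>q\<close> times \<open>F t\<close> plus the sum of \<open>F ((i k) t)\<close>
  over the remaining points \<open>k\<close>, and multiplication by a transposition cuts or joins cycles. The
  solution, found by Stanley, is
  \<open>F s q = (\<Prod>\<^sub>A (1 - E\<^sup>|\<^sup>A\<^sup>|)) q(q + 1)\<dots>(q + n) / (n (n + 1))\<close>, where \<open>A\<close> ranges over the
  cycles of \<open>s\<close> and \<open>E\<close> is the shift \<open>q \<mapsto> q - 1\<close>.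

  With \<open>E = exp (-t)\<close>, where \<open>t\<close> is differentiation, each factor \<open>1 - exp (- c t)\<close> is \<open>c t\<close> times a
  series whose coefficient of \<open>t\<^sup>j\<close> is a multiple of \<open>c\<^sup>j\<close>. The coefficient of \<open>q\<^sup>m\<close> only involves powers
  of \<open>t\<close> up to \<open>n + 1 - m = d + 2g\<close>, of which \<open>d\<close> are used up by the factors \<open>c t\<close>; so it is the
  product of the parts times a symmetric polynomial of degree at most \<open>2g\<close>. The product of the
  parts cancels against the size of the conjugacy class.
\<close>

section \<open>Orbits under multiplication by a transposition\<close>

definition orbits_on :: "'a set \<Rightarrow> ('a \<Rightarrow> 'a) \<Rightarrow> 'a set set" where
  "orbits_on S p = orbit p ` S"

lemma finite_orbits_on [simp]: "finite S \<Longrightarrow> finite (orbits_on S p)"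
  by (simp add: orbits_on_def)

lemma permutes_self_in_orbit: "p permutes S \<Longrightarrow> finite S \<Longrightarrow> x \<in> orbit p x"
  by (meson permutation_permutes permutation_self_in_orbit)

lemma permutes_orbit_eq:
  "p permutes S \<Longrightarrow> finite S \<Longrightarrow> y \<in> orbit p x \<Longrightarrow> orbit p y = orbit p x"
  by (meson cyclic_on_orbit orbit_cyclic_eq3)

text \<open>The least positive return time \<open>funpow_dist1 p i i\<close> of \<open>i\<close> is
  the size of its orbit. The exponents below it are coordinates on the cycle; cutting, joining and
  conjugating cycles are all computed in them.\<close>

lemma orbit_funpow_bij:
  assumes "p permutes S" "finite S"
  shows "bij_betw (\<lambda>k. (p ^^ k) i) {..<card (orbit p i)} (orbit p i)"
    and "(p ^^ card (orbit p i)) i = i" and "card (orbit p i) > 0"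
proof -
  have self: "i \<in> orbit p i" using assms by (rule permutes_self_in_orbit)
  let ?L = "funpow_dist1 p i i"
  have bij: "bij_betw (\<lambda>k. (p ^^ k) i) {0..<?L} (orbit p i)"
    using inj_on_funpow_dist1[OF self] orbit_conv_funpow_dist1[OF self]
    by (simp add: bij_betw_def)
  then have L: "card (orbit p i) = ?L"
    by (metis bij_betw_same_card card_atLeastLessThan minus_nat.diff_0)
  show "bij_betw (\<lambda>k. (p ^^ k) i) {..<card (orbit p i)} (orbit p i)"
    using bij unfolding L by (simp add: lessThan_atLeast0)
  show "(p ^^ card (orbit p i)) i = i" unfolding L by (rule funpow_dist1_prop[OF self])
  show "card (orbit p i) > 0" unfolding L by simp
qed

text \<open>The transposition alters \<open>p\<close> only at points whose image is \<open>i\<close>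
  or \<open>j\<close>, and such points lie in the orbits of \<open>i\<close> and
  \<open>j\<close>.\<close>

lemma orbit_transpose_other:
  assumes "p permutes S" "finite S" "orbit p x \<noteq> orbit p i" "orbit p x \<noteq> orbit p j"
  shows "orbit (transpose i j \<circ> p) x = orbit p x"
proof (rule orbit_cong[OF permutes_self_in_orbit[OF assms(1,2)]])
  fix s assume s: "s \<in> orbit p x"
  then have "p s \<in> orbit p x" by (rule orbit.step)
  then have "p s \<noteq> i" "p s \<noteq> j" using permutes_orbit_eq[OF assms(1,2)] assms(3,4) by auto
  then show "(transpose i j \<circ> p) s = p s" by simp
qed

text \<open>The part common to cutting and joining: once the new orbits of \<open>i\<close> and
  \<open>j\<close> are known to cover the old ones, every other orbit survives by
  \<open>orbit_transpose_other\<close>.\<close>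

lemma orbits_on_transpose_outer:
  assumes p: "p permutes S" "finite S" and ij: "i \<in> S" "j \<in> S"
    and U: "orbit (transpose i j \<circ> p) i \<union> orbit (transpose i j \<circ> p) j = orbit p i \<union> orbit p j"
  shows "orbits_on S (transpose i j \<circ> p) =
     {orbit (transpose i j \<circ> p) i, orbit (transpose i j \<circ> p) j} \<union>
     (orbits_on S p - {orbit p i, orbit p j})"
proof -
  let ?q = "transpose i j \<circ> p"
  have q: "?q permutes S" using p ij by (meson permutes_compose permutes_swap_id)
  note peq = permutes_orbit_eq[OF p] and qeq = permutes_orbit_eq[OF q p(2)]
    and pself = permutes_self_in_orbit[OF p] and other = orbit_transpose_other[OF p, of _ i j]
  have "orbit ?q x \<in> {orbit ?q i, orbit ?q j} \<union> (orbits_on S p - {orbit p i, orbit p j})"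
    if x: "x \<in> S" for x
  proof (cases "x \<in> orbit p i \<union> orbit p j")
    case True
    then show ?thesis using U qeq by blast
  next
    case False
    then have ne: "orbit p x \<noteq> orbit p i" "orbit p x \<noteq> orbit p j" using pself[of x] by auto
    then show ?thesis using x other[OF ne] by (simp add: orbits_on_def)
  qed
  moreover have "orbit p x \<in> orbit ?q ` S"
    if "x \<in> S" "orbit p x \<notin> {orbit p i, orbit p j}" for x
    using that other[of x] by auto
  ultimately show ?thesis using ij unfolding orbits_on_def by blast
qed

text \<open>The new permutation follows \<open>p\<close> along the cycle of \<open>i\<close>,
  crosses over to \<open>j\<close> where \<open>p\<close> would return to \<open>i\<close>, and then
  runs through the cycle of \<open>j\<close>.\<close>

lemma orbits_on_join:
  assumes p: "p permutes S" "finite S" and ij: "i \<in> S" "j \<in> S"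
    and ne: "orbit p i \<noteq> orbit p j"
  shows "orbits_on S (transpose i j \<circ> p) =
    insert (orbit p i \<union> orbit p j) (orbits_on S p - {orbit p i, orbit p j})"
proof -
  let ?q = "transpose i j \<circ> p"
  have q: "?q permutes S" using p ij by (meson permutes_compose permutes_swap_id)
  let ?Li = "card (orbit p i)" and ?Lj = "card (orbit p j)"
  note bi = orbit_funpow_bij[OF p, of i] and bj = orbit_funpow_bij[OF p, of j]
  have disj: "orbit p i \<inter> orbit p j = {}"
    using permutes_orbit_eq[OF p] ne by blast
  have qi: "(?q ^^ k) i = (p ^^ k) i" if "k < ?Li" for k
    using that
  proof (induction k)
    case (Suc k)
    have mem: "(p ^^ Suc k) i \<in> orbit p i" using bij_betwE[OF bi(1)] Suc by blast
    have "(p ^^ Suc k) i \<noteq> (p ^^ 0) i"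
      by (metis bi(1,3) bij_betw_imp_inj_on inj_onD lessThan_iff nat.distinct(1) Suc.prems)
    moreover have "(p ^^ Suc k) i \<noteq> j"
      using mem disj permutes_self_in_orbit[OF p, of j] by auto
    ultimately show ?case using Suc by simp
  qed simp
  \<comment> \<open>At the last step \<open>p\<close> closes its cycle at \<open>i\<close>, and the
    transposition redirects this to \<open>j\<close>.\<close>
  have qiL: "(?q ^^ ?Li) i = j"
  proof -
    obtain k where k: "?Li = Suc k" using bi(3) by (cases ?Li) auto
    then have "(?q ^^ ?Li) i = transpose i j ((p ^^ ?Li) i)" using qi[of k] by simp
    then show ?thesis using bi(2) by simp
  qed
  have qj: "(?q ^^ k) j = (p ^^ k) j" if "k < ?Lj" for k
    using that
  proof (induction k)
    case (Suc k)
    have mem: "(p ^^ Suc k) j \<in> orbit p j" using bij_betwE[OF bj(1)] Suc by blast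
    have "(p ^^ Suc k) j \<noteq> (p ^^ 0) j"
      by (metis bj(1,3) bij_betw_imp_inj_on inj_onD lessThan_iff nat.distinct(1) Suc.prems)
    moreover have "(p ^^ Suc k) j \<noteq> i"
      using mem disj permutes_self_in_orbit[OF p, of i] by auto
    ultimately show ?case using Suc by simp
  qed simp
  have "(p ^^ k) i \<in> orbit ?q i" if "k < ?Li" for k
    using qi[OF that] funpow_in_orbit[OF permutes_self_in_orbit[OF q p(2)]] by metis
  then have 1: "orbit p i \<subseteq> orbit ?q i"
    by (metis bij_betw_imp_surj_on[OF bi(1)] image_subsetI lessThan_iff)
  have "j \<in> orbit ?q i" using qiL funpow_in_orbit[OF permutes_self_in_orbit[OF q p(2)]] by metis
  then have qij: "orbit ?q j = orbit ?q i" by (rule permutes_orbit_eq[OF q p(2)])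
  have "(p ^^ k) j \<in> orbit ?q j" if "k < ?Lj" for k
    using qj[OF that] funpow_in_orbit[OF permutes_self_in_orbit[OF q p(2)]] by metis
  then have 2: "orbit p j \<subseteq> orbit ?q i"
    by (metis bij_betw_imp_surj_on[OF bj(1)] image_subsetI lessThan_iff qij)
  \<comment> \<open>Closure of the union under the new permutation gives the reverse
    inclusion.\<close>
  have step: "?q x \<in> orbit p i \<union> orbit p j" if "x \<in> orbit p i \<union> orbit p j" for x
    using that orbit.step[of x p i] orbit.step[of x p j]
      permutes_self_in_orbit[OF p, of i] permutes_self_in_orbit[OF p, of j]
    by (auto simp: transpose_def)
  have "y \<in> orbit p i \<union> orbit p j" if "y \<in> orbit ?q i" for y
    using that
    by induct (use step permutes_self_in_orbit[OF p] in blast)+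
  with 1 2 have "orbit ?q i = orbit p i \<union> orbit p j" by blast
  with qij orbits_on_transpose_outer[OF p ij] show
    "orbits_on S ?q = insert (orbit p i \<union> orbit p j) (orbits_on S p - {orbit p i, orbit p j})"
    by auto
qed

text \<open>With \<open>j = p^b i\<close>, the new permutation follows \<open>p\<close> from
  \<open>i\<close> until \<open>p\<close> would reach \<open>j\<close>, where it returns to
  \<open>i\<close>. From \<open>j\<close> it follows \<open>p\<close> until \<open>p\<close> would
  reach \<open>i\<close>, where it returns to \<open>j\<close>. So the exponents below
  \<open>b\<close> and those from \<open>b\<close> on become separate cycles.\<close>

lemma orbits_on_cut:
  assumes p: "p permutes S" "finite S" and i: "i \<in> S"
    and b: "0 < b" "b < card (orbit p i)"
  obtains A B where
    "orbits_on S (transpose i ((p ^^ b) i) \<circ> p) = {A, B} \<union> (orbits_on S p - {orbit p i})"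
    "A \<inter> B = {}" "A \<union> B = orbit p i" "card A = b" "card B = card (orbit p i) - b"
proof -
  let ?L = "card (orbit p i)"
  define j where "j = (p ^^ b) i"
  let ?q = "transpose i j \<circ> p"
  note bi = orbit_funpow_bij[OF p, of i]
  have inj: "(p ^^ k) i \<noteq> (p ^^ l) i" if "k < ?L" "l < ?L" "k \<noteq> l" for k l
    using bij_betw_imp_inj_on[OF bi(1)] that unfolding inj_on_def by blast
  have jmem: "j \<in> orbit p i" using bij_betwE[OF bi(1)] b unfolding j_def by blast
  have j: "j \<in> S" using permutes_orbit_subset[OF p(1) i] jmem by blast
  have q: "?q permutes S" using p i j by (meson permutes_compose permutes_swap_id)
  have qi: "(?q ^^ k) i = (p ^^ k) i" if "k < b" for k
    using that
  proof (induction k)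
    case (Suc k)
    then show ?case using inj[of "Suc k" 0] inj[of "Suc k" b] b by (simp add: j_def)
  qed simp
  have qib: "(?q ^^ b) i = i"
  proof -
    obtain k where k: "b = Suc k" using b by (cases b) auto
    then have "(?q ^^ b) i = transpose i j ((p ^^ b) i)" using qi[of k] by simp
    then show ?thesis by (simp add: j_def)
  qed
  have qj: "(?q ^^ k) j = (p ^^ (b + k)) i" if "b + k < ?L" for k
    using that
  proof (induction k)
    case (Suc k)
    then show ?case using inj[of "b + Suc k" 0] inj[of "b + Suc k" b] b by (simp add: j_def)
  qed (simp add: j_def)
  have qjb: "(?q ^^ (?L - b)) j = j"
  proof -
    obtain k where k: "?L - b = Suc k" using b by (cases "?L - b") auto
    then have L: "?L = Suc (b + k)" using b by simp
    have "(?q ^^ (?L - b)) j = transpose i j ((p ^^ ?L) i)" using qj[of k] k L by simp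
    then show ?thesis using bi(2) by simp
  qed
  let ?f = "\<lambda>k. (p ^^ k) i"
  have "orbit ?q i = (\<lambda>m. (?q ^^ m) i) ` {..<b}"
    by (subst orbit_altdef_bounded[OF qib b(1)]) auto
  also have "\<dots> = ?f ` {..<b}" by (rule image_cong[OF refl]) (rule qi, simp)
  finally have A: "orbit ?q i = ?f ` {..<b}" .
  have "orbit ?q j = (\<lambda>m. (?q ^^ m) j) ` {..<?L - b}"
    using b by (subst orbit_altdef_bounded[OF qjb]) auto
  also have "\<dots> = (\<lambda>m. ?f (b + m)) ` {..<?L - b}"
    by (rule image_cong[OF refl]) (rule qj, simp)
  also have "\<dots> = ?f ` {b..<?L}"
  proof -
    have "(\<lambda>m. b + m) ` {..<?L - b} = {b..<?L}"
      using b image_add_atLeastLessThan[of b 0 "?L - b"] by (simp add: lessThan_atLeast0)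
    then show ?thesis using image_image[of ?f "(+) b" "{..<?L - b}"] by metis
  qed
  finally have B: "orbit ?q j = ?f ` {b..<?L}" .
  have injf: "inj_on ?f {..<?L}" using bij_betw_imp_inj_on[OF bi(1)] .
  have sub: "{..<b} \<subseteq> {..<?L}" "{b..<?L} \<subseteq> {..<?L}" using b by auto
  have disj: "orbit ?q i \<inter> orbit ?q j = {}" unfolding A B
    using inj_on_image_Int[OF injf sub] by (auto simp: ivl_disj_int)
  have "orbit ?q i \<union> orbit ?q j = ?f ` ({..<b} \<union> {b..<?L})" unfolding A B by blast
  also have "{..<b} \<union> {b..<?L} = {..<?L}" using b by auto
  finally have un: "orbit ?q i \<union> orbit ?q j = orbit p i"
    by (simp only: bij_betw_imp_surj_on[OF bi(1)])
  have pj: "orbit p j = orbit p i" using permutes_orbit_eq[OF p jmem] .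
  have "card (orbit ?q i) = b" "card (orbit ?q j) = ?L - b" unfolding A B
    using card_image[OF inj_on_subset[OF injf sub(1)]] card_image[OF inj_on_subset[OF injf sub(2)]]
    by simp_all
  moreover have "orbits_on S ?q = {orbit ?q i, orbit ?q j} \<union> (orbits_on S p - {orbit p i})"
    using orbits_on_transpose_outer[OF p i j] un pj by simp
  ultimately show ?thesis using that disj un unfolding j_def by blast
qed

lemma orbits_on_disjoint:
  assumes "p permutes S" "finite S" "A \<in> orbits_on S p" "B \<in> orbits_on S p" "A \<noteq> B"
  shows "A \<inter> B = {}"
  using assms permutes_orbit_eq[OF assms(1,2)] unfolding orbits_on_def by blast

lemma orbits_on_nonempty: "A \<in> orbits_on S p \<Longrightarrow> A \<noteq> {}"
  using orbit_nonempty unfolding orbits_on_def by fastforce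

lemma Union_orbits_on:
  assumes "p permutes S" "finite S" shows "\<Union> (orbits_on S p) = S"
  using permutes_orbit_subset[OF assms(1)] permutes_self_in_orbit[OF assms]
  unfolding orbits_on_def by fast

section \<open>Orbits under conjugation and under insertion of a point\<close>

lemma orbit_image_conj:
  assumes w: "w permutes S" and p: "p permutes S" "finite S"
  shows "orbit (w \<circ> p \<circ> inv w) (w x) = w ` orbit p x"
  by (rule orbit_inverse[symmetric])
    (use permutes_self_in_orbit[OF p] permutes_inverses[OF w] in auto)

lemma orbits_on_conj:
  assumes w: "w permutes S" and p: "p permutes S" "finite S"
  shows "orbits_on S (w \<circ> p \<circ> inv w) = (`) w ` orbits_on S p"
proof -
  have "orbits_on S (w \<circ> p \<circ> inv w) = orbit (w \<circ> p \<circ> inv w) ` w ` S"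
    using w by (simp add: orbits_on_def permutes_image)
  then show ?thesis using orbit_image_conj[OF w p] by (simp add: orbits_on_def image_image)
qed

lemma orbits_on_subset: "p permutes S \<Longrightarrow> A \<in> orbits_on S p \<Longrightarrow> A \<subseteq> S"
  using permutes_orbit_subset unfolding orbits_on_def by fast

lemma orbits_on_fixed:
  assumes "p permutes S" "z \<notin> S"
  shows "orbits_on (insert z S) p = insert {z} (orbits_on S p)"
  using permutes_not_in[OF assms] by (simp add: orbits_on_def orbit_eq_singleton_iff[THEN iffD2])

text \<open>On the larger set \<open>z\<close> is a fixed point of \<open>p\<close>, so this is the
  join of the singleton orbit \<open>{z}\<close> with the orbit of \<open>k\<close>.\<close>

lemma orbits_on_insert:
  assumes p: "p permutes S" "finite S" and z: "z \<notin> S" and k: "k \<in> S"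
  shows "orbits_on (insert z S) (transpose z k \<circ> p) =
    insert (insert z (orbit p k)) (orbits_on S p - {orbit p k})"
proof -
  have p': "p permutes insert z S" using p(1) by (rule permutes_imp_permutes_insert)
  have z': "orbit p z = {z}" using permutes_not_in[OF p(1) z] by (simp add: orbit_eq_singleton_iff)
  have "{z} \<notin> orbits_on S p" using orbits_on_subset[OF p(1)] z by auto
  moreover have "orbit p k \<subseteq> S" using permutes_orbit_subset[OF p(1) k] .
  ultimately show ?thesis
    using orbits_on_join[OF p', of z k] p(2) k z z' orbits_on_fixed[OF p(1) z] by auto
qed

lemma card_orbits_on_insert:
  assumes p: "p permutes S" "finite S" and z: "z \<notin> S" and k: "k \<in> S"
  shows "card (orbits_on (insert z S) (transpose z k \<circ> p)) = card (orbits_on S p)"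
proof -
  have "orbit p k \<in> orbits_on S p" using k by (simp add: orbits_on_def)
  moreover have "insert z (orbit p k) \<notin> orbits_on S p" using orbits_on_subset[OF p(1)] z by blast
  moreover have "finite (orbits_on S p)" using p(2) by simp
  ultimately show ?thesis
    unfolding orbits_on_insert[OF assms] by (metis DiffD1 card_Suc_Diff1 card_insert_disjoint finite_Diff)
qed

lemma card_orbits_on_fixed:
  assumes p: "p permutes S" "finite S" and z: "z \<notin> S"
  shows "card (orbits_on (insert z S) p) = Suc (card (orbits_on S p))"
  using orbits_on_subset[OF p(1)] z p(2) unfolding orbits_on_fixed[OF p(1) z] by force

section \<open>Polynomials in the shift operator\<close>

text \<open>The linear functional sending the monomial \<open>X^i\<close> to \<open>a i\<close>.
  When \<open>a i\<close> is a function value after \<open>i\<close> shifts, polynomials act as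
  operators and their product is composition.\<close>

definition lin_ext :: "(nat \<Rightarrow> 'a::comm_ring_1) \<Rightarrow> 'a poly \<Rightarrow> 'a" where
  "lin_ext a f = (\<Sum>i\<le>degree f. coeff f i * a i)"

lemma lin_ext_eq: "degree f \<le> M \<Longrightarrow> lin_ext a f = (\<Sum>i\<le>M. coeff f i * a i)"
  unfolding lin_ext_def by (rule sum.mono_neutral_left) (auto simp: coeff_eq_0)

lemma lin_ext_add: "lin_ext a (f + g) = lin_ext a f + lin_ext a g"
proof -
  have "degree (f + g) \<le> max (degree f) (degree g)" by (rule degree_add_le) auto
  then show ?thesis
    by (subst (1 2 3) lin_ext_eq[of _ "max (degree f) (degree g)"])
      (auto simp: sum.distrib algebra_simps)
qed

lemma lin_ext_0 [simp]: "lin_ext a 0 = 0"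
  by (simp add: lin_ext_def)

lemma lin_ext_smult: "lin_ext a (smult c f) = c * lin_ext a f"
  by (subst lin_ext_eq[of _ "degree f"])
    (auto simp: lin_ext_def sum_distrib_left mult.assoc degree_smult_le)

lemma lin_ext_of_nat_mult: "lin_ext a (of_nat k * f) = of_nat k * lin_ext a f"
  using lin_ext_smult[of a "of_nat k" f] by (simp add: of_nat_poly)

lemma lin_ext_diff: "lin_ext a (f - g) = lin_ext a f - lin_ext a g"
  using lin_ext_add[of a f "smult (-1) g"] lin_ext_smult[of a "-1" g] by simp

lemma lin_ext_sum: "lin_ext a (sum f A) = (\<Sum>x\<in>A. lin_ext a (f x))"
  by (induction A rule: infinite_finite_induct) (simp_all add: lin_ext_add)

lemma lin_ext_fun_diff: "lin_ext (\<lambda>i. a i - b i) f = lin_ext a f - lin_ext b f"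
  by (simp add: lin_ext_def sum_subtractf algebra_simps)

lemma lin_ext_fun_add: "lin_ext (\<lambda>i. a i + b i) f = lin_ext a f + lin_ext b f"
  by (simp add: lin_ext_def sum.distrib algebra_simps)

lemma lin_ext_fun_mult: "lin_ext (\<lambda>i. c * a i) f = c * lin_ext a f"
  by (simp add: lin_ext_def sum_distrib_left mult_ac)

lemma lin_ext_pCons: "lin_ext a (pCons c f) = c * a 0 + lin_ext (\<lambda>i. a (Suc i)) f"
proof -
  have "lin_ext a (pCons c f) = (\<Sum>i\<le>Suc (degree f). coeff (pCons c f) i * a i)"
    by (rule lin_ext_eq) (rule degree_pCons_le)
  then show ?thesis by (simp add: sum.atMost_Suc_shift lin_ext_def del: sum.atMost_Suc)
qed

lemma lin_ext_monom_mult: "lin_ext a (monom 1 c * f) = lin_ext (\<lambda>i. a (i + c)) f"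
proof (induction c arbitrary: a)
  case (Suc c)
  then show ?case by (simp add: monom_Suc lin_ext_pCons)
qed simp

lemma lin_ext_one_minus_monom_mult:
  "lin_ext a ((1 - monom 1 c) * f) = lin_ext (\<lambda>i. a i - a (i + c)) f"
  by (simp add: left_diff_distrib lin_ext_diff lin_ext_monom_mult lin_ext_fun_diff)

text \<open>The Euler operator \<open>X d/dX\<close> multiplies \<open>X^i\<close> by
  \<open>i\<close>; this is how a factor \<open>i\<close> on the sequence is moved to the
  polynomial.\<close>

lemma lin_ext_pderiv: "lin_ext a (monom 1 1 * pderiv f) = lin_ext (\<lambda>i. of_nat i * a i) f"
proof -
  have "monom 1 1 * pderiv f = pCons 0 (pderiv f)" by (simp add: monom_Suc)
  moreover have "degree (pCons 0 (pderiv f)) \<le> Suc (degree f)"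
    by (rule degree_le) (auto simp: coeff_pCons coeff_pderiv coeff_eq_0 split: nat.splits)
  moreover have "coeff (pCons 0 (pderiv f)) i = of_nat i * coeff f i" for i
    by (cases i) (simp_all add: coeff_pderiv)
  ultimately show ?thesis
    by (subst (1 2) lin_ext_eq[of _ "Suc (degree f)"]) (simp_all add: mult_ac)
qed

text \<open>Applies a polynomial in the shift operator \<open>(E \<phi>)(q) = \<phi>(q - 1)\<close> to the rising factorial of
  length \<open>N\<close>.\<close>
definition umbral :: "nat \<Rightarrow> rat \<Rightarrow> rat poly \<Rightarrow> rat" where
  "umbral N q = lin_ext (\<lambda>i. pochhammer (q - of_nat i) N)"

text \<open>The operator \<open>1 - E\<close> is the backward difference, which lowers a rising
  factorial of length \<open>N + 1\<close> to \<open>N + 1\<close> times the one of length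
  \<open>N\<close>.\<close>

lemma umbral_Suc_mult:
  "umbral (Suc N) q ((1 - monom 1 1) * h) = of_nat (Suc N) * umbral N q h"
proof -
  have "pochhammer y (Suc N) - pochhammer (y - 1) (Suc N) = of_nat (Suc N) * pochhammer y N"
    for y :: rat
    by (subst pochhammer_rec', subst pochhammer_rec) (simp add: algebra_simps)
  from this[of "q - of_nat i" for i] show ?thesis
    unfolding umbral_def lin_ext_one_minus_monom_mult lin_ext_fun_mult[symmetric]
    by (simp add: algebra_simps)
qed

text \<open>Write \<open>q = (q - i + N) - N + i\<close>: the bracket lengthens the rising factorial
  of \<open>q - i\<close>, and the last \<open>i\<close> is the Euler operator. Multiplication by
  \<open>q\<close> thus becomes an operation on the polynomial.\<close>

lemma umbral_mult_argument:
  "q * umbral N q f =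
    umbral (Suc N) q f - of_nat N * umbral N q f + umbral N q (monom 1 1 * pderiv f)"
proof -
  have "q * y = ((q - i) + of_nat N) * y - of_nat N * y + i * y" for y i :: rat
    by (simp add: algebra_simps)
  then show ?thesis unfolding umbral_def lin_ext_pderiv
    by (simp only: lin_ext_fun_mult[symmetric] lin_ext_fun_add[symmetric]
      lin_ext_fun_diff[symmetric] pochhammer_rec')
qed

section \<open>The cut-and-join recurrence as an identity of polynomials in the shift\<close>

lemma sum_monom_telescope:
  "(1 - monom 1 1) * (\<Sum>b\<in>{1..<Suc l}. monom 1 b) = (monom 1 1 - monom 1 (Suc l) :: rat poly)"
proof (induction l)
  case (Suc l)
  have "(\<Sum>b\<in>{1..<Suc (Suc l)}. monom 1 b) = (\<Sum>b\<in>{1..<Suc l}. monom 1 b) + (monom 1 (Suc l) :: rat poly)"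
    by (rule sum.atLeastLessThan_Suc) simp
  then show ?case using Suc by (simp only: distrib_left) (simp add: algebra_simps mult_monom)
qed simp

text \<open>Here \<open>l\<close> is the length of the cycle receiving the new point,
  \<open>\<Gamma>\<close> the set of the other cycles, and \<open>n\<close> the number of points
  after the insertion. The first sum in \<open>G\<close> comes from the cuts, the second from the
  joins, where \<open>c x\<close> counts the points of the joined cycle. The term \<open>f\<close>
  with its derivative encodes \<open>q\<close> times the old product, as in
  \<open>umbral_mult_argument\<close>.\<close>

lemma cut_join_polynomial_identity:
  fixes c :: "'b \<Rightarrow> nat" and l :: nat
  assumes "finite \<Gamma>" and n: "n = Suc l + sum c \<Gamma>" and l: "l > 0"
  defines "P \<equiv> (\<Prod>x\<in>\<Gamma>. 1 - monom 1 (c x)) :: rat poly"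
  defines "f \<equiv> (1 - monom 1 l) * P"
  defines "G \<equiv> (\<Sum>b\<in>{1..<l}. (1 - monom 1 b) * (1 - monom 1 (l - b)) * P) +
     (\<Sum>x\<in>\<Gamma>. of_nat (c x) * ((1 - monom 1 (l + c x)) * (\<Prod>y\<in>\<Gamma>-{x}. 1 - monom 1 (c y))))"
  shows "of_nat (n - 1) * ((1 - monom 1 (Suc l)) * P) =
     of_nat (Suc n) * f + (1 - monom 1 1) * (monom 1 1 * pderiv f - of_nat n * f + G)"
proof -
  let ?X = "monom 1 1 :: rat poly" and ?Y = "monom 1 l :: rat poly"
  let ?R = "\<lambda>x. \<Prod>y\<in>\<Gamma>-{x}. 1 - monom 1 (c y) :: rat poly"
  have Xd: "?X * pderiv (monom 1 k) = of_nat k * monom 1 k" for k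
    by (cases k) (simp_all add: pderiv_monom mult_monom of_nat_poly smult_monom)
  have XP: "?X * pderiv P = - (\<Sum>x\<in>\<Gamma>. of_nat (c x) * monom 1 (c x) * ?R x)"
    unfolding P_def pderiv_prod
    by (simp add: sum_distrib_left pderiv_diff Xd mult.left_commute[of ?X] flip: sum_negf)
      (simp add: Xd mult_ac flip: Xd)
  have "?X * pderiv f = - of_nat l * ?Y * P + (1 - ?Y) * (?X * pderiv P)"
    using Xd[of l] unfolding f_def by (simp add: pderiv_mult pderiv_diff algebra_simps)
  then have Xf: "?X * pderiv f = - of_nat l * ?Y * P -
      (\<Sum>x\<in>\<Gamma>. (1 - ?Y) * of_nat (c x) * monom 1 (c x) * ?R x)"
    unfolding XP by (simp add: sum_distrib_left mult.assoc)
  have PR: "P = (1 - monom 1 (c x)) * ?R x" if "x \<in> \<Gamma>" for x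
    unfolding P_def using that assms(1) by (simp add: prod.remove)
  \<comment> \<open>With \<open>Z = X^(c x)\<close>, the relation
    \<open>(1 - Y Z) - (1 - Y) Z = 1 - Z\<close> turns each join term, up to the matching term of
    the derivative, into \<open>c x\<close> times \<open>P\<close>.\<close>
  have "(\<Sum>x\<in>\<Gamma>. of_nat (c x) * ((1 - monom 1 (l + c x)) * ?R x)) -
      (\<Sum>x\<in>\<Gamma>. (1 - ?Y) * of_nat (c x) * monom 1 (c x) * ?R x) =
      (\<Sum>x\<in>\<Gamma>. of_nat (c x) * P)"
    unfolding sum_subtractf[symmetric]
  proof (rule sum.cong[OF refl])
    fix x assume "x \<in> \<Gamma>"
    have "monom 1 (l + c x) = ?Y * monom 1 (c x)" by (simp add: mult_monom)
    then show "of_nat (c x) * ((1 - monom 1 (l + c x)) * ?R x) -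
      (1 - ?Y) * of_nat (c x) * monom 1 (c x) * ?R x = of_nat (c x) * P"
      unfolding PR[OF \<open>x \<in> \<Gamma>\<close>] by (simp add: algebra_simps)
  qed
  then have G2: "(\<Sum>x\<in>\<Gamma>. of_nat (c x) * ((1 - monom 1 (l + c x)) * ?R x)) =
      (\<Sum>x\<in>\<Gamma>. (1 - ?Y) * of_nat (c x) * monom 1 (c x) * ?R x) + of_nat (sum c \<Gamma>) * P"
    unfolding of_nat_sum sum_distrib_right by (simp only: diff_eq_eq add.commute)
  \<comment> \<open>Each cut term contributes \<open>1 + Y - X^b - X^(l - b)\<close>, so two copies
    of this geometric sum remain; the outer factor \<open>1 - X\<close> telescopes them.\<close>
  define E where "E = (\<Sum>b\<in>{1..<l}. monom 1 b :: rat poly)"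
  have E: "(1 - ?X) * E = ?X - ?Y"
    using sum_monom_telescope[of "l - 1"] l unfolding E_def by simp
  have rev: "(\<Sum>b\<in>{1..<l}. monom 1 (l - b) :: rat poly) = E"
    unfolding E_def by (rule sum.reindex_bij_witness[of _ "\<lambda>b. l - b" "\<lambda>b. l - b"]) auto
  have "(\<Sum>b\<in>{1..<l}. (1 - monom 1 b) * (1 - monom 1 (l - b)) * P) =
     (\<Sum>b\<in>{1..<l}. (1 + ?Y - monom 1 b - monom 1 (l - b))) * P"
    unfolding sum_distrib_right
    by (rule sum.cong) (auto simp: algebra_simps mult_monom)
  also have "\<dots> = (of_nat (l - 1) * (1 + ?Y) - E - E) * P"
    by (simp only: sum_subtractf rev) (simp add: E_def)
  finally have G1: "(\<Sum>b\<in>{1..<l}. (1 - monom 1 b) * (1 - monom 1 (l - b)) * P) =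
    (of_nat (l - 1) * (1 + ?Y) - E - E) * P" .
  have lS: "monom 1 (Suc l) = ?X * ?Y" by (simp add: mult_monom)
  obtain l' where l': "l = Suc l'" using l by (cases l) auto
  have "(1 - ?X) * (?X * pderiv f - of_nat n * f + G) =
    (1 - ?X) * (- of_nat l * ?Y - of_nat n * (1 - ?Y) + of_nat (sum c \<Gamma>)
      + of_nat (l - 1) * (1 + ?Y)) * P - 2 * ((1 - ?X) * E) * P"
    unfolding G_def G1 G2 Xf unfolding f_def by (simp only: algebra_simps)
  also have "\<dots> = (1 - ?X) * (- of_nat l * ?Y - of_nat n * (1 - ?Y) + of_nat (sum c \<Gamma>)
      + of_nat (l - 1) * (1 + ?Y)) * P - 2 * (?X - ?Y) * P" unfolding E ..
  finally have main: "(1 - ?X) * (?X * pderiv f - of_nat n * f + G) = \<dots>" .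
  \<comment> \<open>What is left is a ring identity in independent \<open>X\<close>,
    \<open>Y\<close> and \<open>P\<close>; writing \<open>l = Suc l'\<close> removes the truncated
    subtraction.\<close>
  have "of_nat (n - 1) * ((1 - X * Y) * P) = of_nat (Suc n) * ((1 - Y) * P) +
     ((1 - X) * (- of_nat l * Y - of_nat n * (1 - Y) + of_nat (sum c \<Gamma>)
      + of_nat (l - 1) * (1 + Y)) * P - 2 * (X - Y) * P)" for X Y :: "rat poly"
    unfolding n l' by (simp add: algebra_simps)
  then show ?thesis unfolding main lS unfolding f_def .
qed

text \<open>Apply \<open>umbral (Suc n) q\<close> to the polynomial identity. The factor
  \<open>1 - E\<close> lowers the length to \<open>n\<close> at the price of \<open>Suc n\<close>,
  and \<open>umbral_mult_argument\<close> collects the terms in \<open>f\<close> into a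
  multiplication by \<open>q\<close>.\<close>

lemma cut_join_umbral_identity:
  fixes c :: "'b \<Rightarrow> nat" and l :: nat
  assumes fin: "finite \<Gamma>" and n: "n = Suc l + sum c \<Gamma>" and l: "l > 0"
  defines "P \<equiv> (\<Prod>x\<in>\<Gamma>. 1 - monom 1 (c x)) :: rat poly"
  shows "of_nat (n - 1) * umbral (Suc n) q ((1 - monom 1 (Suc l)) * P) =
     of_nat (Suc n) * (q * umbral n q ((1 - monom 1 l) * P)
       + (\<Sum>b\<in>{1..<l}. umbral n q ((1 - monom 1 b) * (1 - monom 1 (l - b)) * P))
       + (\<Sum>x\<in>\<Gamma>. of_nat (c x) *
            umbral n q ((1 - monom 1 (l + c x)) * (\<Prod>y\<in>\<Gamma>-{x}. 1 - monom 1 (c y)))))"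
proof -
  let ?f = "(1 - monom 1 l) * P"
  let ?G = "(\<Sum>b\<in>{1..<l}. (1 - monom 1 b) * (1 - monom 1 (l - b)) * P) +
     (\<Sum>x\<in>\<Gamma>. of_nat (c x) * ((1 - monom 1 (l + c x)) * (\<Prod>y\<in>\<Gamma>-{x}. 1 - monom 1 (c y))))"
  have "of_nat (n - 1) * umbral (Suc n) q ((1 - monom 1 (Suc l)) * P) =
    umbral (Suc n) q (of_nat (n - 1) * ((1 - monom 1 (Suc l)) * P))"
    by (simp only: umbral_def lin_ext_of_nat_mult)
  also have "\<dots> = of_nat (Suc n) * umbral (Suc n) q ?f +
     umbral (Suc n) q ((1 - monom 1 1) * (monom 1 1 * pderiv ?f - of_nat n * ?f + ?G))"
    unfolding P_def cut_join_polynomial_identity[OF fin n l]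
    by (simp only: umbral_def lin_ext_of_nat_mult lin_ext_add)
  also have "umbral (Suc n) q ((1 - monom 1 1) * (monom 1 1 * pderiv ?f - of_nat n * ?f + ?G)) =
    of_nat (Suc n) * (umbral n q (monom 1 1 * pderiv ?f) - of_nat n * umbral n q ?f + umbral n q ?G)"
    unfolding umbral_Suc_mult
    by (simp only: umbral_def lin_ext_of_nat_mult lin_ext_add lin_ext_diff)
  also have "umbral n q ?G =
      (\<Sum>b\<in>{1..<l}. umbral n q ((1 - monom 1 b) * (1 - monom 1 (l - b)) * P))
       + (\<Sum>x\<in>\<Gamma>. of_nat (c x) *
            umbral n q ((1 - monom 1 (l + c x)) * (\<Prod>y\<in>\<Gamma>-{x}. 1 - monom 1 (c y))))"
    by (simp only: umbral_def lin_ext_of_nat_mult lin_ext_add lin_ext_sum)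
  finally show ?thesis unfolding umbral_mult_argument by (simp only: algebra_simps)
qed

section \<open>Counting by the number of cycles of the second factor\<close>

definition full_cycles :: "'a set \<Rightarrow> ('a \<Rightarrow> 'a) set" where
  "full_cycles S = {w. w permutes S \<and> orbits_on S w = {S}}"

lemma finite_full_cycles [simp]: "finite S \<Longrightarrow> finite (full_cycles S)"
  unfolding full_cycles_def by (rule finite_subset[OF _ finite_permutations]) auto

lemma full_cycles_singleton: "full_cycles {x} = {id}"
  by (auto simp: full_cycles_def orbits_on_def orbit_eq_singleton_iff)

text \<open>A full cycle determines \<open>k\<close> as the image of \<open>z\<close>, and then
  \<open>w\<close> by undoing the transposition. Conversely \<open>orbits_on_insert\<close> shows
  that the product is a full cycle exactly when \<open>w\<close> is one.\<close>

lemma full_cycles_insert: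
  assumes S: "finite S" "S \<noteq> {}" and z: "z \<notin> S"
  shows "bij_betw (\<lambda>(k, w). transpose z k \<circ> w) (S \<times> full_cycles S) (full_cycles (insert z S))"
  unfolding bij_betw_def
proof
  show "inj_on (\<lambda>(k, w). transpose z k \<circ> w) (S \<times> full_cycles S)"
  proof (intro inj_onI, clarify)
    fix k w l v assume "w \<in> full_cycles S" "v \<in> full_cycles S"
      and eq: "transpose z k \<circ> w = transpose z l \<circ> v"
    then have "w z = z" "v z = z" using z by (auto simp: full_cycles_def permutes_not_in)
    then have "k = l" using fun_cong[OF eq, of z] by simp
    moreover have "transpose z k \<circ> (transpose z k \<circ> w) = transpose z k \<circ> (transpose z l \<circ> v)"
      using eq by simp
    ultimately show "k = l \<and> w = v" by (simp flip: comp_assoc)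
  qed
  show "(\<lambda>(k, w). transpose z k \<circ> w) ` (S \<times> full_cycles S) = full_cycles (insert z S)"
  proof (intro equalityI subsetI)
    fix u assume "u \<in> (\<lambda>(k, w). transpose z k \<circ> w) ` (S \<times> full_cycles S)"
    then obtain k w where u: "u = transpose z k \<circ> w" and k: "k \<in> S" and w: "w \<in> full_cycles S"
      by auto
    then have wS: "w permutes S" "orbits_on S w = {S}" by (auto simp: full_cycles_def)
    then have "orbit w k = S" using k by (auto simp: orbits_on_def)
    moreover have "u permutes insert z S" unfolding u
      using k wS(1) by (meson insertCI permutes_compose permutes_imp_permutes_insert permutes_swap_id)
    ultimately show "u \<in> full_cycles (insert z S)"
      using orbits_on_insert[OF wS(1) S(1) z k] wS(2) by (simp add: full_cycles_def u)
  next
    fix u assume u: "u \<in> full_cycles (insert z S)"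
    then have "u \<in> {p. p permutes insert z S}" by (simp add: full_cycles_def)
    then obtain k w where uw: "u = transpose z k \<circ> w" "k \<in> insert z S" "w permutes S"
      unfolding permutes_insert by auto
    have sub: "A \<subseteq> S" if "A \<in> orbits_on S w" for A using orbits_on_subset uw(3) that .
    have uo: "orbits_on (insert z S) u = {insert z S}" using u by (simp add: full_cycles_def)
    \<comment> \<open>For \<open>k = z\<close> the point \<open>z\<close> would be fixed, making
      \<open>{z}\<close> an orbit smaller than the whole set.\<close>
    have "k \<noteq> z" using orbits_on_fixed[OF uw(3) z] uo uw(1) S(2) z by auto
    then have k: "k \<in> S" using uw(2) by simp
    have o: "insert (insert z (orbit w k)) (orbits_on S w - {orbit w k}) = {insert z S}"
      using orbits_on_insert[OF uw(3) S(1) z k] uo uw(1) by simp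
    then have "insert z (orbit w k) = insert z S" by blast
    then have "orbit w k = S"
      using permutes_orbit_subset[OF uw(3) k] z by (metis insert_ident subsetD)
    moreover have "orbits_on S w - {orbit w k} = {}" using o sub z by blast
    moreover have "orbit w k \<in> orbits_on S w" using k by (simp add: orbits_on_def)
    ultimately have "orbits_on S w = {S}" by blast
    then show "u \<in> (\<lambda>(k, w). transpose z k \<circ> w) ` (S \<times> full_cycles S)"
      using uw k by (auto simp: full_cycles_def)
  qed
qed

lemma card_full_cycles:
  assumes "finite S" "S \<noteq> {}" shows "card (full_cycles S) = fact (card S - 1)"
  using assms
proof (induction S rule: finite_ne_induct)
  case (singleton x)
  then show ?case by (simp add: full_cycles_singleton)
next
  case (insert z S)
  then obtain m where "card S = Suc m" by (metis card_0_eq not0_implies_Suc)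
  then show ?case
    using bij_betw_same_card[OF full_cycles_insert[OF insert(1,2,3)]] insert
    by (simp add: card_cartesian_product)
qed

text \<open>This is \<open>F s q\<close> above: the exponent counts the cycles of the second factor
  in \<open>s \<circ> \<pi> = w\<close>.\<close>

definition factorization_gf :: "'a set \<Rightarrow> ('a \<Rightarrow> 'a) \<Rightarrow> rat \<Rightarrow> rat" where
  "factorization_gf S s q = (\<Sum>w\<in>full_cycles S. q ^ card (orbits_on S (inv s \<circ> w)))"

lemma factorization_gf_insert:
  assumes S: "finite S" "S \<noteq> {}" and z: "z \<notin> S"
  shows "factorization_gf (insert z S) t q =
    (\<Sum>k\<in>S. \<Sum>w\<in>full_cycles S. q ^ card (orbits_on (insert z S) (inv t \<circ> (transpose z k \<circ> w))))"
  unfolding factorization_gf_def sum.cartesian_product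
  by (rule sum.reindex_bij_betw[OF full_cycles_insert[OF assms], symmetric, THEN trans])
    (simp add: case_prod_unfold)

lemma comp_transpose: "inj f \<Longrightarrow> f \<circ> transpose a b = transpose (f a) (f b) \<circ> f"
  by (auto simp: fun_eq_iff transpose_def inj_eq)

text \<open>Moving \<open>(z k)\<close> to the left through \<open>inv s\<close> gives
  \<open>(z k')\<close> with \<open>k'\<close> in \<open>S\<close>. It only inserts \<open>z\<close>
  into an existing cycle of the second factor, so all choices of \<open>k\<close> contribute
  equally.\<close>

lemma factorization_gf_fixed:
  assumes S: "finite S" "S \<noteq> {}" and z: "z \<notin> S" and s: "s permutes S"
  shows "factorization_gf (insert z S) s q = of_nat (card S) * factorization_gf S s q"
proof -
  have si: "inv s permutes S" using s by (rule permutes_inv)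
  have "card (orbits_on (insert z S) (inv s \<circ> (transpose z k \<circ> w))) =
      card (orbits_on S (inv s \<circ> w))" if k: "k \<in> S" and w: "w \<in> full_cycles S" for k w
  proof -
    have "inv s \<circ> (transpose z k \<circ> w) = transpose z (inv s k) \<circ> (inv s \<circ> w)"
      using comp_transpose[OF permutes_inj[OF si], of z k] permutes_not_in[OF si z]
      by (simp flip: comp_assoc)
    moreover have "inv s \<circ> w permutes S"
      using w si by (auto simp: full_cycles_def intro: permutes_compose)
    moreover have "inv s k \<in> S" using permutes_in_image[OF si] k by simp
    ultimately show ?thesis using card_orbits_on_insert S(1) z by metis
  qed
  then show ?thesis
    unfolding factorization_gf_insert[OF S z] unfolding factorization_gf_def by simp
qed

text \<open>For \<open>k = i\<close> the two transpositions cancel and \<open>z\<close> becomes a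
  new fixed point of the second factor, whence the factor \<open>q\<close>. For other
  \<open>k\<close>, \<open>(z i)(z k) = (z k)(i k)\<close>: the part \<open>(z k)\<close> moves left
  and inserts \<open>z\<close> without changing the number of cycles, while \<open>(i k)\<close> is
  absorbed into \<open>s\<close>.\<close>

lemma factorization_gf_nonfixed:
  assumes S: "finite S" and z: "z \<notin> S" and s: "s permutes S" and i: "i \<in> S"
  shows "factorization_gf (insert z S) (transpose z i \<circ> s) q =
    q * factorization_gf S s q + (\<Sum>k\<in>S-{i}. factorization_gf S (transpose i k \<circ> s) q)"
proof -
  have si: "inv s permutes S" using s by (rule permutes_inv)
  have inv: "inv (transpose a b \<circ> s) = inv s \<circ> transpose a b" for a b
    using permutes_bij[OF s] by (simp add: o_inv_distrib)
  have "card (orbits_on (insert z S) (inv (transpose z i \<circ> s) \<circ> (transpose z i \<circ> w))) =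
      Suc (card (orbits_on S (inv s \<circ> w)))" if w: "w \<in> full_cycles S" for w
  proof -
    have "inv s \<circ> w permutes S"
      using w si by (auto simp: full_cycles_def intro: permutes_compose)
    moreover have "inv (transpose z i \<circ> s) \<circ> (transpose z i \<circ> w) = inv s \<circ> w"
      unfolding inv by (simp add: fun_eq_iff)
    ultimately show ?thesis using card_orbits_on_fixed S(1) z by metis
  qed
  then have fixed: "(\<Sum>w\<in>full_cycles S. q ^ card (orbits_on (insert z S)
      (inv (transpose z i \<circ> s) \<circ> (transpose z i \<circ> w)))) = q * factorization_gf S s q"
    by (simp add: factorization_gf_def sum_distrib_left)
  have "card (orbits_on (insert z S) (inv (transpose z i \<circ> s) \<circ> (transpose z k \<circ> w))) =
      card (orbits_on S (inv (transpose i k \<circ> s) \<circ> w))"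
    if k: "k \<in> S - {i}" and w: "w \<in> full_cycles S" for k w
  proof -
    have "k \<noteq> i" "k \<noteq> z" "i \<noteq> z" using k i z by auto
    then have "transpose z i \<circ> transpose z k = transpose z k \<circ> transpose i k"
      by (auto simp: fun_eq_iff transpose_def)
    then have "inv s \<circ> transpose z i \<circ> (transpose z k \<circ> w) =
        inv s \<circ> transpose z k \<circ> (transpose i k \<circ> w)"
      by (metis comp_assoc)
    also have "\<dots> = transpose z (inv s k) \<circ> (inv s \<circ> transpose i k \<circ> w)"
      using comp_transpose[OF permutes_inj[OF si], of z k] permutes_not_in[OF si z]
      by (simp flip: comp_assoc)
    finally have "inv (transpose z i \<circ> s) \<circ> (transpose z k \<circ> w) =
      transpose z (inv s k) \<circ> (inv (transpose i k \<circ> s) \<circ> w)" unfolding inv .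
    moreover have "inv s \<circ> transpose i k \<circ> w permutes S"
      using w si k i by (auto simp: full_cycles_def intro!: permutes_compose permutes_swap_id)
    moreover have "inv s k \<in> S" using permutes_in_image[OF si] k by simp
    ultimately show ?thesis using card_orbits_on_insert S(1) z inv by metis
  qed
  then have "(\<Sum>k\<in>S-{i}. \<Sum>w\<in>full_cycles S. q ^ card (orbits_on (insert z S)
      (inv (transpose z i \<circ> s) \<circ> (transpose z k \<circ> w)))) =
      (\<Sum>k\<in>S-{i}. factorization_gf S (transpose i k \<circ> s) q)"
    by (simp add: factorization_gf_def)
  moreover have "S \<noteq> {}" using i by auto
  ultimately show ?thesis
    unfolding factorization_gf_insert[OF S \<open>S \<noteq> {}\<close> z] using fixed
    by (simp add: sum.remove[OF S i])
qed

section \<open>Stanley's formula for a fixed first factor\<close>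

definition orbit_poly :: "'a set \<Rightarrow> ('a \<Rightarrow> 'a) \<Rightarrow> rat poly" where
  "orbit_poly S p = (\<Prod>A\<in>orbits_on S p. 1 - monom 1 (card A))"

lemma sum_card_orbits_on:
  assumes "p permutes S" "finite S"
  shows "sum card (orbits_on S p) = card S"
proof -
  have "finite A" if "A \<in> orbits_on S p" for A
    using orbits_on_subset[OF assms(1) that] assms(2) finite_subset by blast
  then have "card (\<Union> (orbits_on S p)) = sum card (orbits_on S p)"
    using orbits_on_disjoint[OF assms]
    by (intro card_Union_disjoint) (auto simp: pairwise_def disjnt_def)
  then show ?thesis by (simp add: Union_orbits_on[OF assms])
qed

text \<open>Both sides obey the same recurrences under insertion of a point. A new fixed point
  multiplies the product by \<open>1 - E\<close>, which \<open>umbral_Suc_mult\<close> absorbs;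
  otherwise the cut-and-join identity applies.\<close>

theorem factorization_gf_eq:
  assumes "finite S" "S \<noteq> {}" "s permutes S"
  shows "factorization_gf S s q =
    umbral (Suc (card S)) q (orbit_poly S s) / of_nat (card S * Suc (card S))"
  using assms
proof (induction S arbitrary: s rule: finite_ne_induct)
  case (singleton x)
  then have s: "s = id" by simp
  have o: "orbits_on {x} id = {{x}}" by (simp add: orbits_on_def orbit_eq_singleton_iff)
  have "umbral (Suc 1) q ((1 - monom 1 1) * 1) = 2 * q"
    by (subst umbral_Suc_mult) (simp add: umbral_def lin_ext_def)
  moreover have "factorization_gf {x} id q = q"
    unfolding factorization_gf_def full_cycles_singleton by (simp add: o del: id_apply flip: id_def)
  moreover have "orbit_poly {x} id = (1 - monom 1 1) * 1" unfolding orbit_poly_def o by simp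
  ultimately show ?case unfolding s by (simp add: id_def)
next
  case (insert z S t)
  let ?N = "card S"
  note S = insert(1,2) and z = insert(3)
  have N: "?N > 0" using S by (simp add: card_gt_0_iff)
  have cz: "card (insert z S) = Suc ?N" using S z by simp
  have "t \<in> {p. p permutes insert z S}" using insert.prems by simp
  then obtain i s where t: "t = transpose z i \<circ> s" "i \<in> insert z S" and s: "s permutes S"
    unfolding permutes_insert by auto
  show ?case
  proof (cases "i = z")
    case True
    then have t: "t = s" using t by simp
    have "{z} \<notin> orbits_on S s" using orbits_on_subset[OF s] z by blast
    then have W: "orbit_poly (insert z S) s = (1 - monom 1 1) * orbit_poly S s"
      using S(1) by (simp add: orbit_poly_def orbits_on_fixed[OF s z])
    show ?thesis
      unfolding t cz factorization_gf_fixed[OF S z s] insert.IH[OF s] W umbral_Suc_mult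
      using N by (simp del: of_nat_Suc mult_Suc mult_Suc_right)
  next
    case False
    then have i: "i \<in> S" using t by simp
    let ?O = "orbit s i"
    define l where "l = card ?O"
    define \<Gamma> where "\<Gamma> = orbits_on S s - {?O}"
    define P where "P = (\<Prod>A\<in>\<Gamma>. 1 - monom 1 (card A) :: rat poly)"
    have fin: "finite \<Gamma>" using S by (simp add: \<Gamma>_def)
    note b = orbit_funpow_bij[OF s S(1), of i, folded l_def]
    have O: "?O \<in> orbits_on S s" using i by (simp add: orbits_on_def)
    then have orbs: "orbits_on S s = insert ?O \<Gamma>" "?O \<notin> \<Gamma>" by (auto simp: \<Gamma>_def)
    have disj: "A \<inter> B = {}" if "A \<in> orbits_on S s" "B \<in> orbits_on S s" "A \<noteq> B" for A B
      using orbits_on_disjoint[OF s S(1) that] .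
    have finS: "finite A" if "A \<in> orbits_on S s" for A
      using orbits_on_subset[OF s that] S(1) finite_subset by blast
    have sumN: "?N = l + sum card \<Gamma>"
      using sum_card_orbits_on[OF s S(1)] fin orbs by (simp add: l_def)
    have W: "orbit_poly S s = (1 - monom 1 l) * P"
      unfolding orbit_poly_def orbs(1) using fin orbs(2) by (simp add: P_def l_def)
    have "insert z ?O \<notin> \<Gamma>" using orbits_on_subset[OF s] z by (auto simp: \<Gamma>_def)
    moreover have "card (insert z ?O) = Suc l"
      using finS[OF O] orbits_on_subset[OF s O] z
      unfolding l_def by (intro card_insert_disjoint) auto
    ultimately have Wt: "orbit_poly (insert z S) t = (1 - monom 1 (Suc l)) * P"
      unfolding orbit_poly_def t(1) orbits_on_insert[OF s S(1) z i]
      using fin by (simp add: P_def flip: \<Gamma>_def)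
    have cut: "orbit_poly S (transpose i ((s ^^ m) i) \<circ> s) =
        (1 - monom 1 m) * (1 - monom 1 (l - m)) * P" if m: "m \<in> {1..<l}" for m
    proof -
      obtain A B where AB: "orbits_on S (transpose i ((s ^^ m) i) \<circ> s) = {A, B} \<union> \<Gamma>"
        "A \<inter> B = {}" "A \<union> B = ?O" "card A = m" "card B = l - m"
        using orbits_on_cut[OF s S(1) i, of m] m unfolding l_def \<Gamma>_def by auto
      \<comment> \<open>The new orbits must differ from each other and from those in
        \<open>\<Gamma>\<close>, since the product runs over a set of orbits and a coincidence would
        lose a factor.\<close>
      have ne: "A \<noteq> {}" "B \<noteq> {}" using AB(4,5) m by auto
      have "C \<noteq> A" "C \<noteq> B" if "C \<in> \<Gamma>" for C
        using disj[of C ?O] O that AB(3) ne by (auto simp: \<Gamma>_def)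
      then have "A \<notin> \<Gamma>" "B \<notin> \<Gamma>" "A \<noteq> B" using AB(2) ne by auto
      then show ?thesis unfolding orbit_poly_def AB(1) using fin AB(4,5)
        by (simp add: P_def mult.assoc)
    qed
    have join: "orbit_poly S (transpose i k \<circ> s) =
        (1 - monom 1 (l + card A)) * (\<Prod>B\<in>\<Gamma>-{A}. 1 - monom 1 (card B))"
      if A: "A \<in> \<Gamma>" and k: "k \<in> A" for A k
    proof -
      have A': "A \<in> orbits_on S s" "A \<noteq> ?O" using A by (auto simp: \<Gamma>_def)
      then have kS: "k \<in> S" using k orbits_on_subset[OF s] by blast
      have Ak: "A = orbit s k"
        using A'(1) k permutes_orbit_eq[OF s S(1)] by (auto simp: orbits_on_def)
      have "orbits_on S (transpose i k \<circ> s) = insert (?O \<union> A) (\<Gamma> - {A})"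
        using orbits_on_join[OF s S(1) i kS] A' unfolding Ak[symmetric] \<Gamma>_def by auto
      moreover have "?O \<union> A \<notin> \<Gamma> - {A}"
        using disj[of "?O \<union> A" ?O] O orbits_on_nonempty[OF O] by (auto simp: \<Gamma>_def)
      moreover have "card (?O \<union> A) = l + card A"
        using finS O A' disj[OF O A'(1)] by (simp add: l_def card_Un_disjoint)
      ultimately show ?thesis using fin by (simp add: orbit_poly_def)
    qed
    have gf: "factorization_gf S (transpose i k \<circ> s) q =
        umbral (Suc ?N) q (orbit_poly S (transpose i k \<circ> s)) / of_nat (?N * Suc ?N)"
      if "k \<in> S" for k
      using that i s by (intro insert.IH) (meson permutes_compose permutes_swap_id)
    have inO: "(s ^^ m) i \<in> ?O" if "m < l" for m using bij_betwE[OF b(1)] that by blast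
    have disjO: "A \<inter> ?O = {}" if "A \<in> \<Gamma>" for A
      using disj[of A ?O] O that by (simp add: \<Gamma>_def)
    \<comment> \<open>Points \<open>k\<close> in the cycle of \<open>i\<close> cut it; points in any
      other cycle join that cycle to it.\<close>
    have split: "S - {i} = (?O - {i}) \<union> \<Union>\<Gamma>"
      using Union_orbits_on[OF s S(1)] orbs permutes_self_in_orbit[OF s S(1), of i]
        disjO by blast
    have "(\<Sum>k\<in>S-{i}. factorization_gf S (transpose i k \<circ> s) q) =
      (\<Sum>k\<in>?O-{i}. factorization_gf S (transpose i k \<circ> s) q) +
      (\<Sum>k\<in>\<Union>\<Gamma>. factorization_gf S (transpose i k \<circ> s) q)"
      unfolding split
    proof (rule sum.union_disjoint)
      show "finite (?O - {i})" "finite (\<Union>\<Gamma>)" using fin finS O by (auto simp: \<Gamma>_def)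
      show "(?O - {i}) \<inter> \<Union>\<Gamma> = {}" using disjO by blast
    qed
    also have "(\<Sum>k\<in>?O-{i}. factorization_gf S (transpose i k \<circ> s) q) =
      (\<Sum>m\<in>{1..<l}. factorization_gf S (transpose i ((s ^^ m) i) \<circ> s) q)"
    proof (rule sum.reindex_bij_betw[symmetric])
      \<comment> \<open>The exponent \<open>0\<close> is left out because it stands for
        \<open>i\<close> itself.\<close>
      have "bij_betw (\<lambda>k. (s ^^ k) i) ({..<l} - {0}) (?O - {(s ^^ 0) i})"
        using b permutes_self_in_orbit[OF s S(1), of i]
        by (intro bij_betw_DiffI) (auto simp: bij_betw_def)
      moreover have "{..<l} - {0} = {1..<l}" by auto
      ultimately show "bij_betw (\<lambda>k. (s ^^ k) i) {1..<l} (?O - {i})" by simp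
    qed
    also have "\<dots> = (\<Sum>m\<in>{1..<l}. umbral (Suc ?N) q
        ((1 - monom 1 m) * (1 - monom 1 (l - m)) * P)) / of_nat (?N * Suc ?N)"
      unfolding sum_divide_distrib
    proof (rule sum.cong[OF refl])
      fix m assume m: "m \<in> {1..<l}"
      then have "(s ^^ m) i \<in> S" using inO orbits_on_subset[OF s O] by auto
      from gf[OF this] show "factorization_gf S (transpose i ((s ^^ m) i) \<circ> s) q =
        umbral (Suc ?N) q ((1 - monom 1 m) * (1 - monom 1 (l - m)) * P) / of_nat (?N * Suc ?N)"
        unfolding cut[OF m] .
    qed
    also have "(\<Sum>k\<in>\<Union>\<Gamma>. factorization_gf S (transpose i k \<circ> s) q) =
      (\<Sum>A\<in>\<Gamma>. \<Sum>k\<in>A. factorization_gf S (transpose i k \<circ> s) q)"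
      using finS disj by (subst sum.Union_disjoint) (auto simp: \<Gamma>_def)
    also have "\<dots> = (\<Sum>A\<in>\<Gamma>. of_nat (card A) * umbral (Suc ?N) q
       ((1 - monom 1 (l + card A)) * (\<Prod>B\<in>\<Gamma>-{A}. 1 - monom 1 (card B)))) / of_nat (?N * Suc ?N)"
      unfolding sum_divide_distrib
    proof (rule sum.cong[OF refl])
      fix A assume A: "A \<in> \<Gamma>"
      have "k \<in> S" if "k \<in> A" for k using A that orbits_on_subset[OF s] by (auto simp: \<Gamma>_def)
      then have "(\<Sum>k\<in>A. factorization_gf S (transpose i k \<circ> s) q) = (\<Sum>k\<in>A. umbral (Suc ?N) q
       ((1 - monom 1 (l + card A)) * (\<Prod>B\<in>\<Gamma>-{A}. 1 - monom 1 (card B))) / of_nat (?N * Suc ?N))"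
        using gf join[OF A] by (intro sum.cong) auto
      then show "(\<Sum>k\<in>A. factorization_gf S (transpose i k \<circ> s) q) = of_nat (card A) * umbral (Suc ?N) q
       ((1 - monom 1 (l + card A)) * (\<Prod>B\<in>\<Gamma>-{A}. 1 - monom 1 (card B))) / of_nat (?N * Suc ?N)"
        by simp
    qed
    finally have sums: "(\<Sum>k\<in>S-{i}. factorization_gf S (transpose i k \<circ> s) q) =
      (\<Sum>m\<in>{1..<l}. umbral (Suc ?N) q
        ((1 - monom 1 m) * (1 - monom 1 (l - m)) * P)) / of_nat (?N * Suc ?N) +
      (\<Sum>A\<in>\<Gamma>. of_nat (card A) * umbral (Suc ?N) q
       ((1 - monom 1 (l + card A)) * (\<Prod>B\<in>\<Gamma>-{A}. 1 - monom 1 (card B)))) / of_nat (?N * Suc ?N)" .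
    have "of_nat (?N * Suc ?N) * factorization_gf (insert z S) t q =
       q * umbral (Suc ?N) q ((1 - monom 1 l) * P)
       + (\<Sum>m\<in>{1..<l}. umbral (Suc ?N) q ((1 - monom 1 m) * (1 - monom 1 (l - m)) * P))
       + (\<Sum>A\<in>\<Gamma>. of_nat (card A) * umbral (Suc ?N) q
       ((1 - monom 1 (l + card A)) * (\<Prod>B\<in>\<Gamma>-{A}. 1 - monom 1 (card B))))"
      unfolding t(1) factorization_gf_nonfixed[OF S(1) z s i] insert.IH[OF s] W sums
      using N by (simp add: distrib_left del: of_nat_Suc of_nat_mult mult_Suc mult_Suc_right)
    \<comment> \<open>The identity is taken at \<open>n = Suc ?N\<close>, the size after insertion,
      so that its factor \<open>n - 1\<close> is \<open>?N\<close> and cancels.\<close>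
    then have "of_nat ?N * umbral (Suc (Suc ?N)) q ((1 - monom 1 (Suc l)) * P) =
      of_nat (Suc (Suc ?N)) * (of_nat (?N * Suc ?N) * factorization_gf (insert z S) t q)"
      using cut_join_umbral_identity[OF fin, of "Suc ?N" l card q] sumN b(3)
      unfolding P_def by simp
    then have "umbral (Suc (Suc ?N)) q ((1 - monom 1 (Suc l)) * P) =
      of_nat (Suc ?N * Suc (Suc ?N)) * factorization_gf (insert z S) t q"
      using N by (simp del: of_nat_Suc mult_Suc mult_Suc_right)
    then show ?thesis unfolding cz Wt by (simp del: of_nat_Suc mult_Suc mult_Suc_right)
  qed
qed

section \<open>Conjugacy classes\<close>

text \<open>The cycle type over an arbitrary set, so that induction can remove a point.\<close>

definition orbit_type :: "'a set \<Rightarrow> ('a \<Rightarrow> 'a) \<Rightarrow> nat multiset" where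
  "orbit_type S p = image_mset card (mset_set (orbits_on S p))"

lemma orbit_type_fixed:
  assumes "p permutes S" "finite S" "z \<notin> S"
  shows "orbit_type (insert z S) p = add_mset 1 (orbit_type S p)"
proof -
  have "{z} \<notin> orbits_on S p" using orbits_on_subset[OF assms(1)] assms(3) by blast
  then show ?thesis using assms by (simp add: orbit_type_def orbits_on_fixed)
qed

lemma orbit_type_insert:
  assumes p: "p permutes S" "finite S" and z: "z \<notin> S" and k: "k \<in> S"
  shows "orbit_type (insert z S) (transpose z k \<circ> p) =
    add_mset (Suc (card (orbit p k))) (orbit_type S p - {#card (orbit p k)#})"
proof -
  let ?R = "orbits_on S p - {orbit p k}"
  have O: "orbit p k \<in> orbits_on S p" using k by (simp add: orbits_on_def)
  have "finite ?R" using p(2) by simp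
  moreover have "insert z (orbit p k) \<notin> ?R" using orbits_on_subset[OF p(1)] z by blast
  moreover have "card (insert z (orbit p k)) = Suc (card (orbit p k))"
    using permutes_orbit_subset[OF p(1) k] z p(2) finite_subset
    by (intro card_insert_disjoint) blast+
  ultimately have "orbit_type (insert z S) (transpose z k \<circ> p) =
    add_mset (Suc (card (orbit p k))) (image_mset card (mset_set ?R))"
    by (simp add: orbit_type_def orbits_on_insert[OF assms])
  moreover have "orbit_type S p = add_mset (card (orbit p k)) (image_mset card (mset_set ?R))"
    using p(2) by (simp add: orbit_type_def mset_set.remove[OF _ O])
  ultimately show ?thesis by simp
qed

lemma sum_mset_eq_sum_count:
  fixes f :: "'a \<Rightarrow> nat"
  assumes "finite A" "set_mset M \<subseteq> A"
  shows "(\<Sum>x\<in>#M. f x) = (\<Sum>x\<in>A. count M x * f x)"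
  using assms(2)
proof (induction M)
  case (add x M)
  have "(\<Sum>y\<in>A. count (add_mset x M) y * f y) =
      (\<Sum>y\<in>A. count M y * f y + (if y = x then f y else 0))"
    by (rule sum.cong) auto
  then show ?case using add assms(1) by (simp add: sum.distrib)
qed simp

lemma sum_mset_orbit_type:
  assumes "p permutes S" "finite S"
  shows "sum_mset (orbit_type S p) = card S"
  using sum_card_orbits_on[OF assms] by (simp add: orbit_type_def sum_unfold_sum_mset)

lemma zero_notin_orbit_type:
  assumes "p permutes S" "finite S"
  shows "0 \<notin># orbit_type S p"
  using orbits_on_nonempty[of _ S p] orbits_on_subset[OF assms(1)] assms(2) finite_subset
  by (fastforce simp: orbit_type_def)

lemma in_mset_le_sum_mset: "(a::nat) \<in># M \<Longrightarrow> a \<le> sum_mset M"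
  by (auto dest!: multi_member_split)

text \<open>Group the points by orbit and the orbits by length: an orbit of length \<open>l\<close>
  accounts for \<open>l\<close> points.\<close>

lemma sum_over_orbit_cards:
  fixes g :: "nat \<Rightarrow> nat"
  assumes p: "p permutes S" "finite S"
  shows "(\<Sum>b\<in>S. g (card (orbit p b))) = (\<Sum>l\<in>{1..card S}. count (orbit_type S p) l * (l * g l))"
proof -
  have fin: "finite A" if "A \<in> orbits_on S p" for A
    using orbits_on_subset[OF p(1) that] p(2) finite_subset by blast
  have "(\<Sum>b\<in>S. g (card (orbit p b))) = (\<Sum>A\<in>orbits_on S p. \<Sum>b\<in>A. g (card (orbit p b)))"
    using fin orbits_on_disjoint[OF p]
    by (subst (1) Union_orbits_on[OF p, symmetric], subst sum.Union_disjoint) auto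
  also have "\<dots> = (\<Sum>A\<in>orbits_on S p. card A * g (card A))"
  proof (rule sum.cong[OF refl])
    fix A assume "A \<in> orbits_on S p"
    then have "orbit p b = A" if "b \<in> A" for b
      using permutes_orbit_eq[OF p] that by (auto simp: orbits_on_def)
    then show "(\<Sum>b\<in>A. g (card (orbit p b))) = card A * g (card A)" by simp
  qed
  also have "\<dots> = (\<Sum>l\<in>#orbit_type S p. l * g l)"
    by (simp add: orbit_type_def sum_unfold_sum_mset multiset.map_comp comp_def)
  also have "\<dots> = (\<Sum>l\<in>{1..card S}. count (orbit_type S p) l * (l * g l))"
  proof (rule sum_mset_eq_sum_count)
    have "l \<in> {1..card S}" if "l \<in># orbit_type S p" for l
      using in_mset_le_sum_mset[OF that] sum_mset_orbit_type[OF p] zero_notin_orbit_type[OF p] that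
      by (cases l) auto
    then show "set_mset (orbit_type S p) \<subseteq> {1..card S}" by blast
  qed simp
  finally show ?thesis .
qed

section \<open>Sizes of conjugacy classes\<close>

definition aut :: "nat multiset \<Rightarrow> nat" where
  "aut M = (\<Prod>y\<in>set_mset M. fact (count M y))"

lemma aut_add_mset: "aut (add_mset x M) = Suc (count M x) * aut M"
proof -
  have "aut (add_mset x M) =
      (\<Prod>y\<in>insert x (set_mset M). (if y = x then Suc (count M x) else 1) * fact (count M y))"
    unfolding aut_def by (rule prod.cong) auto
  also have "\<dots> = Suc (count M x) * (\<Prod>y\<in>insert x (set_mset M). fact (count M y))"
    by (simp add: prod.distrib)
  also have "(\<Prod>y\<in>insert x (set_mset M). fact (count M y)) = aut M"
    unfolding aut_def by (rule prod.mono_neutral_right) (auto simp: not_in_iff)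
  finally show ?thesis .
qed

text \<open>The classical product of \<open>i^(a_i) a_i!\<close>, with \<open>a_i\<close> the
  multiplicity of the part \<open>i\<close>: the order of the centralizer of a permutation of type
  \<open>M\<close>.\<close>

definition centralizer_order :: "nat multiset \<Rightarrow> nat" where
  "centralizer_order M = prod_mset M * aut M"

lemma centralizer_order_add_mset:
  "centralizer_order (add_mset x M) = x * Suc (count M x) * centralizer_order M"
  by (simp only: centralizer_order_def aut_add_mset prod_mset.add_mset mult_ac)

definition conj_class :: "'a set \<Rightarrow> nat multiset \<Rightarrow> ('a \<Rightarrow> 'a) set" where
  "conj_class S M = {p. p permutes S \<and> orbit_type S p = M}"

lemma finite_conj_class [simp]: "finite S \<Longrightarrow> finite (conj_class S M)"
  unfolding conj_class_def by (rule finite_subset[OF _ finite_permutations]) auto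

lemma card_conj_class_eq_sum:
  "finite S \<Longrightarrow> card (conj_class S M) = (\<Sum>p | p permutes S. of_bool (orbit_type S p = M))"
  by (simp add: conj_class_def finite_permutations Int_def)

text \<open>Induction on the set. Every permutation of \<open>insert z S\<close> is
  \<open>(z b) p\<close>: for \<open>b = z\<close> it gains a fixed point, otherwise the cycle of
  \<open>b\<close> grows by one. After multiplication by the centralizer order, each part of
  \<open>M\<close> contributes its size times \<open>fact (card S)\<close>, and the sizes add up to
  \<open>card S + 1\<close>.\<close>

theorem card_conj_class:
  assumes "finite S" "0 \<notin># M" "sum_mset M = card S"
  shows "card (conj_class S M) * centralizer_order M = fact (card S)"
  using assms
proof (induction S arbitrary: M rule: finite_induct)
  case empty
  then have "M = {#}" by (metis card.empty multiset_nonemptyE in_mset_le_sum_mset le_zero_eq)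
  then have "conj_class ({} :: 'a set) M = {id}" by (auto simp: conj_class_def orbit_type_def orbits_on_def)
  then show ?case using \<open>M = {#}\<close> by (simp add: centralizer_order_def aut_def)
next
  case (insert z S)
  let ?N = "card S"
  note S = insert(1) and z = insert(2)
  have sumM: "sum_mset M = Suc ?N" using insert by simp
  define C1 where "C1 = (\<Sum>p | p permutes S. of_bool (add_mset 1 (orbit_type S p) = M) :: nat)"
  define g where "g p l = (of_bool (add_mset (Suc l) (orbit_type S p - {#l#}) = M) :: nat)"
    for p :: "'a \<Rightarrow> 'a" and l
  define M' where "M' l = add_mset l (M - {#Suc l#})" for l
  have "card (conj_class (insert z S) M) =
    (\<Sum>b\<in>insert z S. \<Sum>p | p permutes S. of_bool (orbit_type (insert z S) (transpose z b \<circ> p) = M))"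
    using card_conj_class_eq_sum[of "insert z S" M] S
    by (simp only: finite_insert sum_over_permutations_insert[OF S z])
  also have "\<dots> = (\<Sum>p | p permutes S. of_bool (orbit_type (insert z S) p = M)) +
    (\<Sum>b\<in>S. \<Sum>p | p permutes S. of_bool (orbit_type (insert z S) (transpose z b \<circ> p) = M))"
    by (subst sum.insert[OF S z]) simp
  also have "(\<Sum>p | p permutes S. of_bool (orbit_type (insert z S) p = M)) = C1"
    unfolding C1_def by (rule sum.cong) (use S z in \<open>auto simp: orbit_type_fixed\<close>)
  also have "(\<Sum>b\<in>S. \<Sum>p | p permutes S. of_bool (orbit_type (insert z S) (transpose z b \<circ> p) = M)) =
    (\<Sum>b\<in>S. \<Sum>p | p permutes S. g p (card (orbit p b)))"
    unfolding g_def
    by (intro sum.cong refl) (use S z in \<open>auto simp: orbit_type_insert\<close>)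
  also have "\<dots> = (\<Sum>p | p permutes S. \<Sum>b\<in>S. g p (card (orbit p b)))"
    by (rule sum.swap)
  also have "\<dots> = (\<Sum>p | p permutes S. \<Sum>l\<in>{1..?N}. count (orbit_type S p) l * (l * g p l))"
    by (rule sum.cong) (use S in \<open>auto simp: sum_over_orbit_cards\<close>)
  also have "\<dots> = (\<Sum>l\<in>{1..?N}. \<Sum>p | p permutes S. count (orbit_type S p) l * (l * g p l))"
    by (rule sum.swap)
  finally have C: "card (conj_class (insert z S) M) =
    C1 + (\<Sum>l\<in>{1..?N}. \<Sum>p | p permutes S. count (orbit_type S p) l * (l * g p l))" .
  have 1: "C1 * centralizer_order M = count M 1 * fact ?N"
  proof (cases "1 \<in># M")
    case False
    then have "C1 = 0" unfolding C1_def by (intro sum.neutral) auto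
    then show ?thesis using False by (simp add: not_in_iff)
  next
    case True
    then obtain D where D: "M = add_mset 1 D" by (metis insert_DiffM)
    then have "C1 = card (conj_class S D)" using S by (simp add: C1_def card_conj_class_eq_sum)
    moreover have "card (conj_class S D) * centralizer_order D = fact ?N"
      using D insert.prems sumM by (intro insert.IH) auto
    ultimately show ?thesis by (simp add: D centralizer_order_add_mset algebra_simps)
  qed
  \<comment> \<open>Shrinking one part \<open>Suc l\<close> of \<open>M\<close> to \<open>l\<close>
    gives the type on \<open>S\<close> to which the induction hypothesis applies.\<close>
  have 2: "(\<Sum>p | p permutes S. count (orbit_type S p) l * (l * g p l)) * centralizer_order M =
      count M (Suc l) * Suc l * fact ?N" if l: "l \<in> {1..?N}" for l
  proof (cases "Suc l \<in># M")
    case False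
    then have "g p l = 0" for p unfolding g_def by auto
    then show ?thesis using False by (simp add: not_in_iff)
  next
    case True
    then obtain D where D: "M = add_mset (Suc l) D" by (metis insert_DiffM)
    \<comment> \<open>Lengthening a part \<open>l\<close> gives \<open>M\<close> exactly when the
      type is \<open>D\<close> with \<open>l\<close> added, and then \<open>l\<close> has
      multiplicity \<open>Suc (count D l)\<close>. The resulting weight is the ratio of the
      centralizer orders of \<open>add_mset l D\<close> and \<open>D\<close>.\<close>
    have "count (orbit_type S p) l * (l * g p l) =
        Suc (count D l) * l * of_bool (orbit_type S p = add_mset l D)" for p
    proof (cases "l \<in># orbit_type S p")
      case True
      then obtain E where "orbit_type S p = add_mset l E" by (metis insert_DiffM)
      then show ?thesis by (simp add: g_def D)
    qed (auto simp: not_in_iff g_def)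
    then have "(\<Sum>p | p permutes S. count (orbit_type S p) l * (l * g p l)) =
        Suc (count D l) * l * card (conj_class S (add_mset l D))"
      using S by (simp only: card_conj_class_eq_sum sum_distrib_left)
    moreover have "card (conj_class S (add_mset l D)) * centralizer_order (add_mset l D) = fact ?N"
      using D insert.prems sumM l by (intro insert.IH) auto
    ultimately have H: "(\<Sum>p | p permutes S. count (orbit_type S p) l * (l * g p l)) *
        centralizer_order D = fact ?N"
      by (simp only: centralizer_order_add_mset mult_ac)
    have "centralizer_order M = Suc l * count M (Suc l) * centralizer_order D"
      by (simp add: D centralizer_order_add_mset)
    then show ?thesis unfolding H[symmetric] by (simp only: mult_ac)
  qed
  have "card (conj_class (insert z S) M) * centralizer_order M =
      (count M 1 + (\<Sum>l\<in>{1..?N}. count M (Suc l) * Suc l)) * fact ?N"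
  proof -
    have "(\<Sum>l\<in>{1..?N}. \<Sum>p | p permutes S. count (orbit_type S p) l * (l * g p l)) *
        centralizer_order M = (\<Sum>l\<in>{1..?N}. count M (Suc l) * Suc l * fact ?N)"
      unfolding sum_distrib_right[of _ "{1..?N}"] by (rule sum.cong[OF refl 2])
    then show ?thesis by (simp only: C distrib_right 1 sum_distrib_right)
  qed
  also have "count M 1 + (\<Sum>l\<in>{1..?N}. count M (Suc l) * Suc l) = (\<Sum>l\<in>{1..Suc ?N}. count M l * l)"
    by (subst sum.atLeast_Suc_atMost) (simp_all add: sum.shift_bounds_cl_Suc_ivl del: sum.cl_ivl_Suc)
  also have "\<dots> = sum_mset M"
  proof -
    have "a \<in> {1..Suc ?N}" if "a \<in># M" for a
      using in_mset_le_sum_mset[OF that] sumM insert.prems(1) that by (cases a) auto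
    then have "set_mset M \<subseteq> {1..Suc ?N}" by blast
    from sum_mset_eq_sum_count[OF finite_atLeastAtMost this, of "\<lambda>x. x"] show ?thesis
      by (simp only: multiset.map_ident)
  qed
  finally show ?case by (simp only: sumM card_insert_disjoint[OF S z] fact_Suc of_nat_id)
qed

section \<open>Exchanging a fixed first factor for a fixed full cycle\<close>

lemma full_cycles_conjugate:
  assumes S: "finite S" and v: "v \<in> full_cycles S" and w: "w \<in> full_cycles S"
  obtains t where "t permutes S" "w = t \<circ> v \<circ> inv t"
proof (cases "S = {}")
  case True
  then show ?thesis using v w that[of id] by (auto simp: full_cycles_def)
next
  case False
  then obtain x where x: "x \<in> S" by auto
  have vp: "v permutes S" "orbit v x = S" and wp: "w permutes S" "orbit w x = S"
    using v w x by (auto simp: full_cycles_def orbits_on_def)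
  let ?n = "card S"
  note bv = orbit_funpow_bij[OF vp(1) S, of x, unfolded vp(2)]
  note bw = orbit_funpow_bij[OF wp(1) S, of x, unfolded wp(2)]
  \<comment> \<open>\<open>f\<close> reads off the exponent of a point along \<open>v\<close>, so
    \<open>t\<close> sends the \<open>k\<close>-th iterate of \<open>x\<close> under
    \<open>v\<close> to the \<open>k\<close>-th under \<open>w\<close>.\<close>
  define f where "f = the_inv_into {..<?n} (\<lambda>k. (v ^^ k) x)"
  define t where "t y = (if y \<in> S then (w ^^ f y) x else y)" for y
  have "bij_betw f S {..<?n}" unfolding f_def by (rule bij_betw_the_inv_into[OF bv(1)])
  from bij_betw_trans[OF this bw(1)] have "bij_betw t S S"
    by (rule bij_betw_cong[THEN iffD1, rotated]) (simp add: t_def)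
  then have t: "t permutes S" by (rule bij_imp_permutes) (simp add: t_def)
  have tv: "t ((v ^^ k) x) = (w ^^ k) x" if "k < ?n" for k
  proof -
    have "f ((v ^^ k) x) = k" unfolding f_def
      using that bij_betw_imp_inj_on[OF bv(1)] by (intro the_inv_into_f_f) auto
    moreover have "(v ^^ k) x \<in> S" using bij_betwE[OF bv(1)] that by blast
    ultimately show ?thesis by (simp add: t_def)
  qed
  have "t (v y) = w (t y)" for y
  proof (cases "y \<in> S")
    case True
    then have "y \<in> (\<lambda>k. (v ^^ k) x) ` {..<?n}"
      by (simp only: bij_betw_imp_surj_on[OF bv(1)])
    then obtain k where k: "k < ?n" "y = (v ^^ k) x" by blast
    show ?thesis
    proof (cases "Suc k < ?n")
      case True
      then show ?thesis using tv[OF k(1)] tv[OF True] k(2) by simp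
    next
      case False
      \<comment> \<open>At the last exponent both cycles close up at \<open>x\<close>.\<close>
      then have n: "?n = Suc k" using k(1) by simp
      have "v y = x" "w ((w ^^ k) x) = x" using bv(2) bw(2) k(2) unfolding n by simp_all
      then show ?thesis using tv[OF k(1)] tv[OF bv(3)] k(2) by simp
    qed
  qed (use vp(1) wp(1) in \<open>simp add: t_def permutes_not_in\<close>)
  then have "t \<circ> v = w \<circ> t" by (simp add: fun_eq_iff)
  then have "w = t \<circ> v \<circ> inv t" using permutes_inv_o(1)[OF t] by (simp add: comp_assoc)
  with t that show ?thesis by blast
qed

lemma orbit_type_conj:
  assumes t: "t permutes S" and p: "p permutes S" "finite S"
  shows "orbit_type S (t \<circ> p \<circ> inv t) = orbit_type S p"
proof -
  have "inj t" using t by (rule permutes_inj)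
  then have "inj_on ((`) t) (orbits_on S p)" "card (t ` A) = card A" for A
    by (auto simp: inj_on_def inj_image_eq_iff intro!: card_image)
  then show ?thesis unfolding orbit_type_def orbits_on_conj[OF assms]
    by (simp add: image_mset_mset_set[symmetric] multiset.map_comp comp_def)
qed

lemma size_orbit_type: "size (orbit_type S p) = card (orbits_on S p)"
  by (simp add: orbit_type_def)

definition cofactors :: "'a set \<Rightarrow> nat multiset \<Rightarrow> nat \<Rightarrow> ('a \<Rightarrow> 'a) \<Rightarrow> ('a \<Rightarrow> 'a) set" where
  "cofactors S M m w = {s \<in> conj_class S M. card (orbits_on S (inv s \<circ> w)) = m}"

text \<open>All full cycles are conjugate, so the two cardinalities agree by symmetry.\<close>
lemma card_cofactors_le:
  assumes S: "finite S" and v: "v \<in> full_cycles S" and w: "w \<in> full_cycles S"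
  shows "card (cofactors S M m v) \<le> card (cofactors S M m w)"
proof -
  obtain t where t: "t permutes S" and wt: "w = t \<circ> v \<circ> inv t"
    using full_cycles_conjugate[OF assms] .
  note ti = permutes_inv_o[OF t]
  have vp: "v permutes S" using v by (simp add: full_cycles_def)
  let ?f = "\<lambda>s. t \<circ> s \<circ> inv t"
  show ?thesis
  proof (rule card_inj_on_le[of ?f])
    show "inj_on ?f (cofactors S M m v)"
    proof (rule inj_on_inverseI)
      show "inv t \<circ> ?f s \<circ> t = s" for s using ti(2) by (metis comp_assoc comp_id id_comp)
    qed
    show "finite (cofactors S M m w)" using S by (simp add: cofactors_def)
    show "?f ` cofactors S M m v \<subseteq> cofactors S M m w"
    proof
      fix u assume "u \<in> ?f ` cofactors S M m v"
      then obtain s where u: "u = ?f s" and s: "s permutes S" "orbit_type S s = M"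
        and m: "card (orbits_on S (inv s \<circ> v)) = m"
        by (auto simp: cofactors_def conj_class_def)
      have up: "u permutes S" unfolding u
        using s(1) t by (intro permutes_compose permutes_inv)
      have "inv u = t \<circ> inv s \<circ> inv t" unfolding u
        using permutes_bij[OF s(1)] permutes_bij[OF t]
        by (simp add: o_inv_distrib bij_comp bij_imp_bij_inv inv_inv_eq comp_assoc)
      then have "inv u \<circ> w = t \<circ> (inv s \<circ> v) \<circ> inv t"
        unfolding wt using ti(2) by (metis comp_assoc comp_id)
      moreover have "inv s \<circ> v permutes S" using s(1) vp by (intro permutes_compose permutes_inv)
      ultimately have "card (orbits_on S (inv u \<circ> w)) = m"
        using orbit_type_conj[OF t _ S, of "inv s \<circ> v"] m by (metis size_orbit_type)
      then show "u \<in> cofactors S M m w"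
        using orbit_type_conj[OF t s(1) S] up s(2) u by (simp add: cofactors_def conj_class_def)
    qed
  qed
qed

text \<open>Count pairs \<open>(s, w)\<close> in two ways: each \<open>s\<close> in the class has
  \<open>K\<close> partners, while each full cycle \<open>w\<close> has as many partners as
  \<open>v\<close>, and there are \<open>fact (card S - 1)\<close> full cycles.\<close>

lemma card_cofactors_eq:
  assumes S: "finite S" "S \<noteq> {}" and v: "v \<in> full_cycles S"
    and K: "\<And>s. s \<in> conj_class S M \<Longrightarrow>
      card {w \<in> full_cycles S. card (orbits_on S (inv s \<circ> w)) = m} = K"
  shows "card (conj_class S M) * K = fact (card S - 1) * card (cofactors S M m v)"
proof -
  have "card (conj_class S M) * K =
    (\<Sum>s\<in>conj_class S M. \<Sum>w\<in>full_cycles S. of_bool (card (orbits_on S (inv s \<circ> w)) = m))"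
    using K S(1) by (simp add: Int_def conj_commute)
  also have "\<dots> = (\<Sum>w\<in>full_cycles S. \<Sum>s\<in>conj_class S M. of_bool (card (orbits_on S (inv s \<circ> w)) = m))"
    by (rule sum.swap)
  also have "\<dots> = (\<Sum>w\<in>full_cycles S. card (cofactors S M m w))"
    using S(1) by (simp add: cofactors_def Int_def)
  also have "\<dots> = (\<Sum>w\<in>full_cycles S. card (cofactors S M m v))"
    by (rule sum.cong) (use card_cofactors_le[OF S(1)] v in \<open>auto intro: antisym\<close>)
  finally show ?thesis using card_full_cycles[OF S] by simp
qed

section \<open>The long cycle and \<open>mu\<close>\<close>

lemma long_cycle_permutes: "long_cycle n permutes {1..n}"
proof (rule bij_imp_permutes)
  have "inj_on (long_cycle n) {1..n}" "long_cycle n ` {1..n} \<subseteq> {1..n}"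
    by (auto simp: inj_on_def long_cycle_def split: if_splits)
  then show "bij_betw (long_cycle n) {1..n} {1..n}"
    by (simp add: bij_betw_def endo_inj_surj)
qed (auto simp: long_cycle_def)

lemma long_cycle_in_full_cycles:
  assumes "n \<ge> 1" shows "long_cycle n \<in> full_cycles {1..n}"
proof -
  note p = long_cycle_permutes[of n] and peq = permutes_orbit_eq[OF long_cycle_permutes finite_atLeastAtMost]
  have pow: "(long_cycle n ^^ k) 1 = Suc k" if "k < n" for k
    using that by (induction k) (auto simp: long_cycle_def)
  have "x \<in> orbit (long_cycle n) 1" if x: "x \<in> {1..n}" for x
  proof -
    obtain k where k: "x = Suc k" "k < n" using x by (cases x) auto
    have "(long_cycle n ^^ k) 1 \<in> orbit (long_cycle n) 1"
      using permutes_self_in_orbit[OF p] by (intro funpow_in_orbit) simp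
    then show ?thesis by (simp only: pow[OF k(2)] k(1))
  qed
  moreover have "orbit (long_cycle n) 1 \<subseteq> {1..n}"
    using permutes_orbit_subset[OF p, of 1] assms by simp
  ultimately have "orbit (long_cycle n) 1 = {1..n}" by blast
  then have "orbit (long_cycle n) x = {1..n}" if "x \<in> {1..n}" for x
    using peq[of x n 1] that by simp
  moreover have "{1..n} \<noteq> {}" using assms by simp
  ultimately have "orbits_on {1..n} (long_cycle n) = {{1..n}}" unfolding orbits_on_def by auto
  then show ?thesis using p by (simp add: full_cycles_def)
qed

text \<open>The first factor determines the second as
  \<open>inv \<sigma> \<circ> long_cycle n\<close>, so pairs are counted by their first
  component.\<close>

lemma mu_eq_card_cofactors:
  "mu n m \<gamma> = card (cofactors {1..n} (mset \<gamma>) m (long_cycle n))"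
proof -
  let ?S = "{1..n}"
  have co: "cofactors ?S (mset \<gamma>) m (long_cycle n) = {s. s permutes ?S \<and> cycle_type n s = mset \<gamma> \<and>
      num_cycles n (inv s \<circ> long_cycle n) = m}"
    by (auto simp: cofactors_def conj_class_def cycle_type_def cycles_of_def num_cycles_def
      orbit_type_def orbits_on_def)
  have "{(\<sigma>, \<pi>). \<sigma> permutes ?S \<and> \<pi> permutes ?S \<and> \<sigma> \<circ> \<pi> = long_cycle n \<and>
      cycle_type n \<sigma> = mset \<gamma> \<and> num_cycles n \<pi> = m} =
    (\<lambda>s. (s, inv s \<circ> long_cycle n)) ` cofactors ?S (mset \<gamma>) m (long_cycle n)"
  proof (intro equalityI subsetI)
    fix x assume "x \<in> {(\<sigma>, \<pi>). \<sigma> permutes ?S \<and> \<pi> permutes ?S \<and> \<sigma> \<circ> \<pi> = long_cycle n \<and>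
      cycle_type n \<sigma> = mset \<gamma> \<and> num_cycles n \<pi> = m}"
    then obtain \<sigma> \<pi> where x: "x = (\<sigma>, \<pi>)" "\<sigma> permutes ?S" "\<sigma> \<circ> \<pi> = long_cycle n"
      "cycle_type n \<sigma> = mset \<gamma>" "num_cycles n \<pi> = m" by auto
    have "inv \<sigma> \<circ> long_cycle n = \<pi>"
      using permutes_inv_o(2)[OF x(2)] x(3) by (metis comp_assoc id_comp)
    then show "x \<in> (\<lambda>s. (s, inv s \<circ> long_cycle n)) ` cofactors ?S (mset \<gamma>) m (long_cycle n)"
      unfolding co using x by auto
  next
    fix x assume "x \<in> (\<lambda>s. (s, inv s \<circ> long_cycle n)) ` cofactors ?S (mset \<gamma>) m (long_cycle n)"
    then obtain s where x: "x = (s, inv s \<circ> long_cycle n)" "s permutes ?S"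
      "cycle_type n s = mset \<gamma>" "num_cycles n (inv s \<circ> long_cycle n) = m"
      unfolding co by auto
    have "s \<circ> (inv s \<circ> long_cycle n) = long_cycle n"
      using permutes_inv_o(1)[OF x(2)] by (metis comp_assoc id_comp)
    moreover have "inv s \<circ> long_cycle n permutes ?S"
      using x(2) by (intro permutes_compose permutes_inv long_cycle_permutes)
    ultimately show "x \<in> {(\<sigma>, \<pi>). \<sigma> permutes ?S \<and> \<pi> permutes ?S \<and> \<sigma> \<circ> \<pi> = long_cycle n \<and>
      cycle_type n \<sigma> = mset \<gamma> \<and> num_cycles n \<pi> = m}"
      using x by simp
  qed
  then show ?thesis by (simp add: mu_def card_image inj_on_def)
qed

section \<open>Extracting the polynomial\<close>

text \<open>These are the unsigned Stirling numbers of the first kind.\<close>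

definition rising_coeff :: "nat \<Rightarrow> nat \<Rightarrow> rat" where
  "rising_coeff N = coeff (\<Prod>j<N. [:of_nat j, 1:])"

lemma pochhammer_eq_sum: "pochhammer x N = (\<Sum>r\<le>N. rising_coeff N r * x ^ r)"
proof -
  let ?P = "\<Prod>j<N. [:of_nat j, 1:] :: rat poly"
  have "degree ?P \<le> sum (degree \<circ> (\<lambda>j. [:of_nat j, 1 :: rat:])) {..<N}"
    by (rule degree_prod_sum_le) simp
  then have "degree ?P \<le> N" by simp
  then have "(\<Sum>r\<le>N. rising_coeff N r * x ^ r) = poly ?P x"
    unfolding rising_coeff_def poly_altdef
    by (intro sum.mono_neutral_right) (auto simp: coeff_eq_0)
  also have "\<dots> = pochhammer x N"
    by (simp add: poly_prod pochhammer_prod lessThan_atLeast0 add.commute)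
  finally show ?thesis ..
qed

lemma coeff_linear_power_general:
  "coeff ([:a, 1:] ^ r) m = of_nat (r choose m) * (a :: rat) ^ (r - m)"
proof (cases "m \<le> r")
  case True
  then show ?thesis by (simp add: coeff_linear_poly_power)
next
  case False
  then show ?thesis by (simp add: degree_linear_power coeff_eq_0 binomial_eq_0)
qed

text \<open>Substitutes \<open>exp (-t)\<close> for the shift: since exponentials turn sums into
  products, a factor \<open>1 - X^c\<close> becomes \<open>1 - exp (-c t)\<close>. The series
  \<open>G\<close> is kept general so that the induction can absorb factors into it.\<close>

lemma lin_ext_fps_exp_prod:
  fixes c :: "'b \<Rightarrow> nat" and G :: "rat fps"
  assumes "finite A"
  shows "lin_ext (\<lambda>i. fps_nth (fps_exp (- of_nat i) * G) k) (\<Prod>x\<in>A. 1 - monom 1 (c x)) =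
    fps_nth (G * (\<Prod>x\<in>A. 1 - fps_exp (- of_nat (c x)))) k"
  using assms
proof (induction A arbitrary: G rule: finite_induct)
  case empty
  then show ?case by (simp add: lin_ext_def)
next
  case (insert x A)
  have "fps_exp (- of_nat (i + c x)) = fps_exp (- of_nat i) * fps_exp (- of_nat (c x) :: rat)" for i
    by (simp flip: fps_exp_add_mult)
  then have "fps_nth (fps_exp (- of_nat i) * G) k - fps_nth (fps_exp (- of_nat (i + c x)) * G) k =
      fps_nth (fps_exp (- of_nat i) * (G * (1 - fps_exp (- of_nat (c x))))) k" for i
    unfolding fps_sub_nth[symmetric] by (simp only: algebra_simps mult_1_right)
  then show ?case using insert
    by (simp add: lin_ext_one_minus_monom_mult mult.assoc del: of_nat_add)
qed

lemma fps_prod_nth_lists: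
  fixes u :: "nat \<Rightarrow> 'a::comm_ring_1 fps"
  assumes "d \<ge> 1"
  shows "fps_nth (\<Prod>i<d. u i) k = (\<Sum>v | length v = d \<and> sum_list v = k. \<Prod>i<d. fps_nth (u i) (v ! i))"
proof -
  obtain e where "d = Suc e" using assms by (cases d) auto
  then show ?thesis using fps_prod_nth[of u e k]
    by (simp add: natpermute_def lessThan_Suc_atMost atLeast0AtMost)
qed

text \<open>The series \<open>(1 - exp (-c t)) / (c t)\<close>, given by coefficients so that the
  \<open>j\<close>-th is visibly \<open>c^j\<close> times a constant.\<close>

definition exp_quotient :: "nat \<Rightarrow> rat fps" where
  "exp_quotient c = Abs_fps (\<lambda>j. (- 1) ^ j * of_nat c ^ j / fact (Suc j))"

lemma one_minus_fps_exp:
  "1 - fps_exp (- of_nat c) = fps_const (of_nat c) * (fps_X * exp_quotient c)"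
proof (rule fps_ext)
  show "fps_nth (1 - fps_exp (- of_nat c)) n = fps_nth (fps_const (of_nat c) * (fps_X * exp_quotient c)) n"
    for n
    by (cases n) (simp_all add: exp_quotient_def power_minus[of "of_nat c"] del: fact_Suc)
qed

lemma prod_over_orbits:
  fixes h :: "nat \<Rightarrow> 'b::comm_monoid_mult"
  assumes "orbit_type S s = mset \<gamma>"
  shows "(\<Prod>A\<in>orbits_on S s. h (card A)) = (\<Prod>i<length \<gamma>. h (\<gamma> ! i))"
proof -
  have "(\<Prod>A\<in>orbits_on S s. h (card A)) = prod_mset (image_mset h (orbit_type S s))"
    by (simp add: prod_unfold_prod_mset orbit_type_def multiset.map_comp comp_def)
  also have "\<dots> = prod_list (map h \<gamma>)" by (simp add: assms prod_mset_prod_list flip: mset_map)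
  also have "\<dots> = (\<Prod>i<length \<gamma>. h (\<gamma> ! i))"
    by (simp add: prod.list_conv_set_nth lessThan_atLeast0)
  finally show ?thesis .
qed

text \<open>The coefficient of \<open>q^m\<close> in the \<open>k\<close>-th derivative of the
  rising factorial of length \<open>N\<close>.\<close>

definition shift_coeff :: "nat \<Rightarrow> nat \<Rightarrow> nat \<Rightarrow> rat" where
  "shift_coeff N m k = rising_coeff N (m + k) * of_nat ((m + k) choose m) * fact k"

text \<open>Compare the coefficients of \<open>q^m\<close> in \<open>factorization_gf_eq\<close>,
  with Taylor's formula expanding the shifted rising factorials on the right.\<close>

lemma card_cofactors_fixed_first:
  fixes S :: "'a set"
  assumes S: "finite S" "S \<noteq> {}" and s: "s permutes S" and m: "m \<le> Suc (card S)"
  shows "of_nat (card {w \<in> full_cycles S. card (orbits_on S (inv s \<circ> w)) = m}) *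
      of_nat (card S * Suc (card S)) =
    (\<Sum>k\<le>Suc (card S) - m. shift_coeff (Suc (card S)) m k *
      fps_nth (\<Prod>A\<in>orbits_on S s. 1 - fps_exp (- of_nat (card A))) k)"
proof -
  let ?N = "Suc (card S)"
  let ?W = "orbit_poly S s"
  define Q where "Q = (\<Sum>w\<in>full_cycles S. monom 1 (card (orbits_on S (inv s \<circ> w))) :: rat poly)"
  \<comment> \<open>\<open>Q\<close> and \<open>R\<close> lift the two sides to polynomials in
    \<open>q\<close>; agreement at every rational point makes them equal after scaling.\<close>
  define R where "R = (\<Sum>i\<le>degree ?W. smult (coeff ?W i)
    (\<Sum>r\<le>?N. smult (rising_coeff ?N r) ([:- of_nat i, 1:] ^ r)))"
  have Nz: "of_nat (card S * ?N) \<noteq> (0 :: rat)" using S by (simp only: of_nat_eq_0_iff) simp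
  have "poly (smult (of_nat (card S * ?N)) Q) q = poly R q" for q
  proof -
    have "poly Q q = factorization_gf S s q"
      by (simp add: Q_def poly_sum poly_monom factorization_gf_def)
    moreover have "poly R q = umbral ?N q ?W"
      by (simp add: R_def umbral_def lin_ext_def poly_sum poly_power pochhammer_eq_sum
        del: sum.atMost_Suc)
    ultimately show ?thesis using factorization_gf_eq[OF S s, of q] Nz by simp
  qed
  then have "smult (of_nat (card S * ?N)) Q = R" by (simp add: poly_eq_poly_eq_iff[symmetric] fun_eq_iff)
  then have "of_nat (card S * ?N) * coeff Q m = coeff R m" by (metis coeff_smult)
  moreover have "coeff Q m = of_nat (card {w \<in> full_cycles S. card (orbits_on S (inv s \<circ> w)) = m})"
    using S(1) by (simp add: Q_def coeff_sum Int_def flip: of_bool_def)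
  moreover have "coeff R m = (\<Sum>k\<le>?N - m. shift_coeff ?N m k *
      fps_nth (\<Prod>A\<in>orbits_on S s. 1 - fps_exp (- of_nat (card A))) k)"
  proof -
    \<comment> \<open>Reindexing by \<open>k = r - m\<close> makes \<open>a^k / fact k\<close>
      appear, the coefficient of \<open>t^k\<close> in \<open>exp (a t)\<close>, used with
      \<open>a = - i\<close>.\<close>
    have inner: "(\<Sum>r\<le>?N. rising_coeff ?N r * (of_nat (r choose m) * a ^ (r - m))) =
        (\<Sum>k\<le>?N - m. shift_coeff ?N m k * (a ^ k / fact k))" for a :: rat
    proof -
      have "(\<Sum>r\<le>?N. rising_coeff ?N r * (of_nat (r choose m) * a ^ (r - m))) =
        (\<Sum>r\<in>{m..?N}. rising_coeff ?N r * (of_nat (r choose m) * a ^ (r - m)))"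
        by (rule sum.mono_neutral_right) (auto simp: binomial_eq_0)
      also have "\<dots> = (\<Sum>k\<le>?N - m. rising_coeff ?N (m + k) * (of_nat ((m + k) choose m) * a ^ k))"
        using m by (intro sum.reindex_bij_witness[of _ "\<lambda>k. m + k" "\<lambda>r. r - m"]) auto
      finally show ?thesis by (simp add: shift_coeff_def mult_ac)
    qed
    have "coeff R m = (\<Sum>i\<le>degree ?W. coeff ?W i *
        (\<Sum>k\<le>?N - m. shift_coeff ?N m k * ((- of_nat i) ^ k / fact k)))"
      unfolding R_def coeff_sum coeff_smult coeff_linear_power_general inner ..
    also have "\<dots> = (\<Sum>k\<le>?N - m. shift_coeff ?N m k *
        (\<Sum>i\<le>degree ?W. coeff ?W i * ((- of_nat i) ^ k / fact k)))"
      unfolding sum_distrib_left by (subst sum.swap) (simp add: mult_ac)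
    also have "\<dots> = (\<Sum>k\<le>?N - m. shift_coeff ?N m k *
        lin_ext (\<lambda>i. fps_nth (fps_exp (- of_nat i) * 1) k) ?W)"
      by (simp add: lin_ext_def)
    finally show ?thesis
      unfolding orbit_poly_def lin_ext_fps_exp_prod[OF finite_orbits_on[OF S(1)]] by simp
  qed
  ultimately show ?thesis by (simp only: mult.commute)
qed

lemma finite_exps: "finite (exps d D)"
proof (rule finite_subset)
  show "exps d D \<subseteq> {xs. set xs \<subseteq> {..D} \<and> length xs = d}"
    using member_le_sum_list by (fastforce simp: exps_def)
qed (rule finite_lists_length_eq, simp)

text \<open>Each of the \<open>d\<close> factors is \<open>c t\<close> times an
  \<open>exp_quotient\<close>. The power \<open>t^d\<close> kills the terms with
  \<open>k < d\<close>, and the remaining coefficients expand over exponent vectors of sum at most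
  \<open>D\<close>.\<close>

lemma exp_quotient_sum:
  assumes d: "length \<gamma> = d" "d \<ge> 1"
  shows "(\<Sum>k\<le>d + D. b k * fps_nth (\<Prod>i<d. 1 - fps_exp (- of_nat (\<gamma> ! i))) k) =
    of_nat (prod_list \<gamma>) * poly_eval d D
      (\<lambda>e. b (d + sum_list e) * (\<Prod>x\<leftarrow>e. (- 1) ^ x / fact (Suc x))) (map of_nat \<gamma>)"
proof -
  let ?U = "\<Prod>i<d. exp_quotient (\<gamma> ! i)"
  have "(\<Prod>i<d. 1 - fps_exp (- of_nat (\<gamma> ! i)) :: rat fps) =
      (\<Prod>i<d. fps_const (of_nat (\<gamma> ! i))) * (fps_X ^ d * ?U)"
    unfolding one_minus_fps_exp by (simp add: prod.distrib)
  also have "(\<Prod>i<d. fps_const (of_nat (\<gamma> ! i))) = fps_const (of_nat (prod_list \<gamma>) :: rat)"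
  proof -
    have "(\<Prod>i\<in>A. fps_const (f i)) = fps_const (\<Prod>i\<in>A. f i)" for A :: "nat set" and f :: "nat \<Rightarrow> rat"
      by (induction A rule: infinite_finite_induct) simp_all
    then show ?thesis using d(1) by (simp add: prod.list_conv_set_nth lessThan_atLeast0)
  qed
  finally have prod: "fps_nth (\<Prod>i<d. 1 - fps_exp (- of_nat (\<gamma> ! i))) k =
      (of_nat (prod_list \<gamma>) :: rat) * (if k < d then 0 else fps_nth ?U (k - d))" for k
    by (simp add: fps_X_power_mult_nth)
  let ?B = "\<lambda>j. b (d + j) * fps_nth ?U j"
  have "(\<Sum>k\<le>d + D. b k * fps_nth (\<Prod>i<d. 1 - fps_exp (- of_nat (\<gamma> ! i))) k) =
      (\<Sum>k\<in>{d..d + D}. b k * (of_nat (prod_list \<gamma>) * fps_nth ?U (k - d)))"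
    unfolding prod by (rule sum.mono_neutral_cong_right) auto
  also have "\<dots> = (\<Sum>j\<le>D. of_nat (prod_list \<gamma>) * ?B j)"
    by (rule sum.reindex_bij_witness[of _ "\<lambda>j. d + j" "\<lambda>k. k - d"]) (auto simp: mult_ac)
  also have "\<dots> = of_nat (prod_list \<gamma>) * (\<Sum>j\<le>D. ?B j)" by (simp add: sum_distrib_left)
  \<comment> \<open>The vectors of sum \<open>j\<close>, for \<open>j\<close> up to
    \<open>D\<close>, partition \<open>exps d D\<close>.\<close>
  also have "(\<Sum>j\<le>D. ?B j) = (\<Sum>j\<le>D. \<Sum>e | e \<in> exps d D \<and> sum_list e = j.
      b (d + sum_list e) * (\<Prod>i<d. fps_nth (exp_quotient (\<gamma> ! i)) (e ! i)))"
  proof (rule sum.cong[OF refl])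
    fix j assume "j \<in> {..D}"
    then have "{e. length e = d \<and> sum_list e = j} = {e. e \<in> exps d D \<and> sum_list e = j}"
      by (auto simp: exps_def)
    then show "?B j = (\<Sum>e | e \<in> exps d D \<and> sum_list e = j.
      b (d + sum_list e) * (\<Prod>i<d. fps_nth (exp_quotient (\<gamma> ! i)) (e ! i)))"
      unfolding fps_prod_nth_lists[OF d(2)] sum_distrib_left by (intro sum.cong) auto
  qed
  also have "\<dots> = (\<Sum>e\<in>exps d D. b (d + sum_list e) *
      (\<Prod>i<d. fps_nth (exp_quotient (\<gamma> ! i)) (e ! i)))"
    by (rule sum.group) (auto simp: finite_exps, simp add: exps_def)
  also have "\<dots> = (\<Sum>e\<in>exps d D. b (d + sum_list e) * (\<Prod>x\<leftarrow>e. (- 1) ^ x / fact (Suc x)) *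
      (\<Prod>i<d. (map of_nat \<gamma> ! i) ^ (e ! i)))"
  proof (rule sum.cong[OF refl])
    fix e assume "e \<in> exps d D"
    then have "length e = d" by (simp add: exps_def)
    then have "(\<Prod>x\<leftarrow>e. (- 1) ^ x / fact (Suc x) :: rat) = (\<Prod>i<d. (- 1) ^ (e ! i) / fact (Suc (e ! i)))"
      by (simp add: prod.list_conv_set_nth lessThan_atLeast0 del: fact_Suc)
    moreover have "(\<Prod>i<d. fps_nth (exp_quotient (\<gamma> ! i)) (e ! i)) =
        (\<Prod>i<d. (- 1) ^ (e ! i) / fact (Suc (e ! i))) * (\<Prod>i<d. (map of_nat \<gamma> ! i) ^ (e ! i))"
      unfolding prod.distrib[symmetric] using d(1)
      by (intro prod.cong) (simp_all add: exp_quotient_def)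
    ultimately show "b (d + sum_list e) * (\<Prod>i<d. fps_nth (exp_quotient (\<gamma> ! i)) (e ! i)) =
      b (d + sum_list e) * (\<Prod>x\<leftarrow>e. (- 1) ^ x / fact (Suc x)) * (\<Prod>i<d. (map of_nat \<gamma> ! i) ^ (e ! i))"
      by simp
  qed
  finally show ?thesis unfolding poly_eval_def .
qed

section \<open>Assembling the symmetric polynomial\<close>

theorem theorem4p5:
  fixes g n d :: nat
  assumes "n \<ge> 1" and "d \<ge> 1" and "1 - 2 * int g + int n - int d \<ge> 1"
  shows "\<exists>c. symmetric_coeffs c \<and>
    (\<forall>\<gamma>. is_partition n d \<gamma> \<longrightarrow>
       of_nat (Aut \<gamma>) / fact n * of_nat (mu n (nat (1 - 2 * int g + int n - int d)) \<gamma>)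
         = poly_eval d (2 * g) c (map of_nat \<gamma>))"
proof -
  define m where "m = nat (1 - 2 * int g + int n - int d)"
  \<comment> \<open>The highest order of \<open>t\<close> is \<open>d + 2 * g\<close>;
    \<open>d\<close> orders go to the factors \<open>c t\<close>, leaving degree
    \<open>2 * g\<close>.\<close>
  have m: "Suc n - m = d + 2 * g" "m \<le> Suc n" using assms unfolding m_def by linarith+
  \<comment> \<open>The coefficients from \<open>exp_quotient_sum\<close>, normalized by
    \<open>fact (Suc n)\<close>. They depend on \<open>e\<close> only through its sum and a product
    over its entries, hence are symmetric.\<close>
  define c where "c e = shift_coeff (Suc n) m (d + sum_list e) / fact (Suc n) *
    (\<Prod>x\<leftarrow>e. (- 1) ^ x / fact (Suc x))" for e
  let ?S = "{1..n}"
  have S: "finite ?S" "?S \<noteq> {}" "card ?S = n" using assms(1) by auto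
  show ?thesis
    unfolding m_def[symmetric]
  proof (intro exI[of _ c] conjI allI impI)
    show "symmetric_coeffs c"
      unfolding symmetric_coeffs_def
    proof (intro allI impI)
      fix e e' :: "nat list" assume "mset e = mset e'"
      then have "sum_list (map f e) = sum_list (map f e')"
        "prod_list (map h e) = prod_list (map h e')" for f :: "nat \<Rightarrow> nat" and h :: "nat \<Rightarrow> rat"
        by (metis mset_map sum_mset_sum_list, metis mset_map prod_mset_prod_list)
      from this(1)[of "\<lambda>x. x"] this(2) show "c e = c e'" unfolding c_def by simp
    qed
  next
    fix \<gamma> assume part: "is_partition n d \<gamma>"
    let ?M = "mset \<gamma>"
    let ?mu = "of_nat (mu n m \<gamma>) :: rat"
    have C: "card (conj_class ?S ?M) * centralizer_order ?M = fact n"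
      using part card_conj_class[of ?S ?M] by (auto simp: is_partition_def sum_mset_sum_list)
    have co: "centralizer_order ?M = prod_list \<gamma> * Aut \<gamma>"
      by (simp add: centralizer_order_def aut_def Aut_def prod_mset_prod_list)
    have len: "length \<gamma> = d" using part by (simp add: is_partition_def)
    define P where "P = poly_eval d (2 * g)
      (\<lambda>e. shift_coeff (Suc n) m (d + sum_list e) * (\<Prod>x\<leftarrow>e. (- 1) ^ x / fact (Suc x))) (map of_nat \<gamma>)"
    define K where "K s = card {w \<in> full_cycles ?S. card (orbits_on ?S (inv s \<circ> w)) = m}" for s
    have K: "of_nat (K s) * of_nat (n * Suc n) = of_nat (prod_list \<gamma>) * P"
      if "s \<in> conj_class ?S ?M" for s
    proof -
      from that have s: "s permutes ?S" "orbit_type ?S s = mset \<gamma>" by (auto simp: conj_class_def)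
      show ?thesis
        using card_cofactors_fixed_first[OF S(1,2) s(1), of m]
          prod_over_orbits[OF s(2), of "\<lambda>c. 1 - fps_exp (- of_nat c) :: rat fps"]
          exp_quotient_sum[OF len assms(2), of "shift_coeff (Suc n) m" "2 * g"]
        unfolding S(3) len m(1) K_def P_def using m(2) by simp
    qed
    \<comment> \<open>The class is nonempty, so a representative \<open>s\<close> fixes the common
      value of \<open>K\<close>.\<close>
    have "card (conj_class ?S ?M) \<noteq> 0" using C by (metis fact_nonzero mult_zero_left)
    then obtain s where s: "s \<in> conj_class ?S ?M" by fastforce
    have "K s' = K s" if "s' \<in> conj_class ?S ?M" for s'
    proof -
      have "of_nat (K s') * of_nat (n * Suc n) = (of_nat (K s) * of_nat (n * Suc n) :: rat)"
        using K[OF that] K[OF s] by simp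
      then show ?thesis using assms(1) by (simp del: of_nat_mult mult_Suc_right of_nat_Suc)
    qed
    then have "card (conj_class ?S ?M) * K s = fact (n - 1) * mu n m \<gamma>"
      unfolding mu_eq_card_cofactors K_def
      using card_cofactors_eq[OF S(1,2) long_cycle_in_full_cycles[OF assms(1)], of ?M m "K s"]
      by (simp add: K_def)
    then have "of_nat (card (conj_class ?S ?M)) * of_nat (K s) = (fact (n - 1) * ?mu :: rat)"
      by (metis of_nat_fact of_nat_mult)
    then have 1: "of_nat (card (conj_class ?S ?M)) * (of_nat (prod_list \<gamma>) * P) =
        fact (n - 1) * ?mu * of_nat (n * Suc n)"
      unfolding K[OF s, symmetric] by (simp only: mult.assoc[symmetric])
    have 2: "of_nat (card (conj_class ?S ?M)) * of_nat (prod_list \<gamma>) * of_nat (Aut \<gamma>) = (fact n :: rat)"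
      using C unfolding co by (metis mult.assoc of_nat_fact of_nat_mult)
    have 3: "fact (Suc n) = (fact (n - 1) * of_nat (n * Suc n) :: rat)"
      using assms(1) by (cases n) (simp_all add: algebra_simps)
    \<comment> \<open>By \<open>2\<close>, class size times product of the parts times
      \<open>Aut \<gamma>\<close> is \<open>fact n\<close>; this cancels the product of the parts
      brought in by \<open>K\<close>.\<close>
    have "fact n * P = of_nat (Aut \<gamma>) * (of_nat (card (conj_class ?S ?M)) * (of_nat (prod_list \<gamma>) * P))"
      unfolding 2[symmetric] by (simp only: mult_ac)
    also have "\<dots> = of_nat (Aut \<gamma>) * ?mu * fact (Suc n)"
      unfolding 1 3 by (simp only: mult_ac)
    finally have "of_nat (Aut \<gamma>) / fact n * ?mu = P / fact (Suc n)"
      by (simp add: divide_simps mult_ac del: fact_Suc)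
    also have "\<dots> = poly_eval d (2 * g) c (map of_nat \<gamma>)"
      unfolding P_def poly_eval_def c_def sum_divide_distrib by (simp add: mult_ac del: fact_Suc)
    finally show "of_nat (Aut \<gamma>) / fact n * ?mu = poly_eval d (2 * g) c (map of_nat \<gamma>)" .
  qed
qed

end
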